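(* For every integer $n \ge 4$ there exists a real-valued function $u\in C^\infty(\mathbb{R}^n)$, $u\not\equiv 0$, satisfying $|\Delta u| \le C|u|$ in $\mathbb{R}^n$ for some constant $C$, such that $$\limsup_{|x_0|\to\infty}\ \min_{|x-x_0|\le 1}\ \frac{\ln\big|\ln|u(x)|\big|}{\ln|x|} = \frac43 .$$
   Context: Here $x_0, x\in\mathbb{R}^n$. The quantity $\ln|\ln|u(x)||$ is understood in the extended real line: it equals $+\infty$ where $u(x)=0$ and $-\infty$ where $|u(x)|=1$. *)

theory Defs
  imports "HOL-Analysis.Analysis"
begin

text \<open>
  \<open>C_diff k f\<close> says that \<open>f\<close> is of class \<open>C\<^sup>k\<close> on the whole space: \<open>f\<close> is differentiable
  and, inductively, each directional derivative \<open>x \<mapsto> Df(x) v\<close> is of class \<open>C\<^sup>k\<^sup>-\<^sup>1\<close>.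
\<close>

primrec C_diff :: "nat \<Rightarrow> ('a::euclidean_space \<Rightarrow> real) \<Rightarrow> bool" where
  "C_diff 0 f \<longleftrightarrow> continuous_on UNIV f"
| "C_diff (Suc k) f \<longleftrightarrow>
     f differentiable_on UNIV \<and> (\<forall>v. C_diff k (\<lambda>x. frechet_derivative f (at x) v))"

definition smooth :: "('a::euclidean_space \<Rightarrow> real) \<Rightarrow> bool" where
  "smooth f \<longleftrightarrow> (\<forall>k. C_diff k f)"

definition partial :: "'a::euclidean_space \<Rightarrow> ('a \<Rightarrow> real) \<Rightarrow> 'a \<Rightarrow> real" where
  "partial e f x = frechet_derivative f (at x) e"

definition laplacian :: "('a::euclidean_space \<Rightarrow> real) \<Rightarrow> 'a \<Rightarrow> real" where
  "laplacian f x = (\<Sum>e\<in>Basis. partial e (partial e f) x)"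

text \<open>
  The logarithm on the extended half-line, with \<open>ln 0 = -\<infinity>\<close> and \<open>ln \<infinity> = \<infinity>\<close>; it is only ever
  applied to nonnegative arguments.
\<close>

definition ext_ln :: "ereal \<Rightarrow> ereal" where
  "ext_ln t = (if t \<le> 0 then -\<infinity> else if t = \<infinity> then \<infinity> else ereal (ln (real_of_ereal t)))"

definition lnln_abs :: "real \<Rightarrow> ereal" where
  "lnln_abs t = ext_ln \<bar>ext_ln (ereal \<bar>t\<bar>)\<bar>"

lemma lnln_abs_0: "lnln_abs 0 = \<infinity>"
  by (simp add: lnln_abs_def ext_ln_def)

lemma lnln_abs_unit: "\<bar>t\<bar> = 1 \<Longrightarrow> lnln_abs t = -\<infinity>"
  by (simp add: lnln_abs_def ext_ln_def)

lemma lnln_abs_real: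
  assumes "t \<noteq> 0" "\<bar>t\<bar> \<noteq> 1"
  shows "lnln_abs t = ereal (ln \<bar>ln \<bar>t\<bar>\<bar>)"
proof -
  have "ln \<bar>t\<bar> \<noteq> 0" using assms by simp
  then show ?thesis using assms by (simp add: lnln_abs_def ext_ln_def)
qed

definition loglog_ratio :: "('a::euclidean_space \<Rightarrow> real) \<Rightarrow> 'a \<Rightarrow> ereal" where
  "loglog_ratio u x = lnln_abs (u x) / ereal (ln (norm x))"

text \<open>
  The minimum over a unit ball is rendered as an infimum in the extended reals. For centres
  with \<open>|x0| > 2\<close>, which are all that matter in the limit, the infimum is attained:
\<close>

lemma continuous_ext_ln: "continuous_on UNIV ext_ln"
proof (rule continuous_onI_mono)
  have "\<exists>s. ext_ln s = t" for t
  proof (cases t)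
    case (real r)
    then show ?thesis by (intro exI[of _ "ereal (exp r)"]) (simp add: ext_ln_def not_le)
  next
    case PInf
    then show ?thesis by (intro exI[of _ "\<infinity>"]) (simp add: ext_ln_def)
  next
    case MInf
    then show ?thesis by (intro exI[of _ 0]) (simp add: ext_ln_def)
  qed
  then have "range ext_ln = UNIV" by (metis surj_def)
  then show "open (range ext_ln)" by simp
next
  fix s t :: ereal
  assume "s \<le> t"
  then show "ext_ln s \<le> ext_ln t"
    by (cases s; cases t) (auto simp: ext_ln_def)
qed

lemma loglog_ratio_attains_inf:
  fixes u :: "'a::euclidean_space \<Rightarrow> real"
  assumes u: "continuous_on UNIV u" and x0: "norm x0 > 2"
  shows "\<exists>x\<in>cball x0 1. loglog_ratio u x = (INF y\<in>cball x0 1. loglog_ratio u y)"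
proof -
  have gt: "norm x > 1" if "x \<in> cball x0 1" for x
    using that x0 norm_triangle_ineq2[of x0 x] by (simp add: dist_norm)
  have ln_gt: "ln (norm x) > 0" if "x \<in> cball x0 1" for x
    using gt[OF that] by (rule ln_gt_zero)
  have lim: "((\<lambda>y. ext_ln (g y)) \<longlongrightarrow> ext_ln c) F" if "(g \<longlongrightarrow> c) F" for g c and F :: "'a filter"
    using continuous_on_tendsto_compose[OF continuous_ext_ln that] by simp
  have "continuous_on (cball x0 1) (loglog_ratio u)"
    unfolding continuous_on_def
  proof
    fix x assume x: "x \<in> cball x0 1"
    let ?F = "at x within cball x0 1"
    have "(u \<longlongrightarrow> u x) ?F"
      using continuous_on_subset[OF u subset_UNIV] x unfolding continuous_on_def by blast
    then have "((\<lambda>y. lnln_abs (u y)) \<longlongrightarrow> lnln_abs (u x)) ?F"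
      unfolding lnln_abs_def
      by (intro lim tendsto_abs_ereal tendsto_ereal tendsto_rabs)
    moreover have "((\<lambda>y. ereal (inverse (ln (norm y)))) \<longlongrightarrow> ereal (inverse (ln (norm x)))) ?F"
      using gt[OF x] ln_gt[OF x]
      by (intro tendsto_ereal tendsto_inverse tendsto_ln tendsto_norm tendsto_ident_at) auto
    ultimately have "((\<lambda>y. lnln_abs (u y) * ereal (inverse (ln (norm y))))
        \<longlongrightarrow> lnln_abs (u x) * ereal (inverse (ln (norm x)))) ?F"
      using ln_gt[OF x] by (intro tendsto_mult_ereal) auto
    moreover have "loglog_ratio u y = lnln_abs (u y) * ereal (inverse (ln (norm y)))"
      if "y \<in> cball x0 1" for y
      using ln_gt[OF that] by (simp add: loglog_ratio_def divide_ereal_def)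
    ultimately show "(loglog_ratio u \<longlongrightarrow> loglog_ratio u x) ?F"
      using tendsto_cong[of "loglog_ratio u" "\<lambda>y. lnln_abs (u y) * ereal (inverse (ln (norm y)))" ?F] x
      by (auto simp: eventually_at_filter)
  qed
  then obtain x where "x \<in> cball x0 1" "\<forall>y\<in>cball x0 1. loglog_ratio u x \<le> loglog_ratio u y"
    using continuous_attains_inf[of "cball x0 1" "loglog_ratio u"] by auto
  then show ?thesis
    by (metis (no_types, lifting) INF_greatest INF_lower antisym)
qed

end

(*
Let S be the entire function with S(0) = 0 and S'(z) = 1 - cos(2 pi sqrt z). On the positive real
axis S(z) is close to z, but S climbs like a staircase: S' is O(1/k^2) on the unit disc about k^2,
where S takes the value k^2. With complex coordinates z, w on R^4 put
  G(z,w) = S(z) S(w) - S(w)^4 / 4,   u = 2 + Re exp(eps G).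
Such a u is harmonic, as G is holomorphic.

Lower bound. At (z,w) = (k^6, k^2) we have S(z) = S(w)^3 and G = 3/4 k^8, and the flatness of S makes
G = 3/4 k^8 + O(1) on the whole unit ball. For small eps the imaginary part of eps G stays small
there, so u is at least exp(c k^8), where |x| is about k^6. This gives the exponent 8/6 = 4/3.

Upper bound. If u is large and zero-free on a unit ball, then by a Harnack inequality the gradient
of G, with components S'(z) S(w) and S'(w) (S(z) - S(w)^3), is bounded at the centre. A short case
analysis then gives Re G = O(|z|^(4/3)); the term - S(w)^4 / 4 handles the case of bounded S'(z) and
S'(w), as max (a x - x^4 / 4) = 3/4 a^(4/3). If u is small on the ball, then it is not smaller than
a power of 1/|x|, because S' is not small at distance 1/4 from the real axis.
*)

theory Submission
  imports Defs "HOL-Complex_Analysis.Complex_Analysis" "HOL-Real_Asymp.Real_Asymp"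
begin

section \<open>Gradient estimate for holomorphic functions with positive real part\<close>

text \<open>The Cayley transform \<open>\<phi>\<close> carries the right half-plane to the unit disc
  and \<open>f z\<close> to 0. Cauchy's inequality bounds its derivative at \<open>z\<close> by
  \<open>1 / r\<close>, and that derivative is \<open>deriv f z / (2 * Re (f z))\<close>.\<close>

lemma norm_deriv_le_Re:
  assumes f: "f holomorphic_on cball z r" and "r > 0"
    and pos: "\<And>x. x \<in> cball z r \<Longrightarrow> Re (f x) > 0"
  shows "norm (deriv f z) * r \<le> 2 * Re (f z)"
proof -
  define b where "b = f z"
  define \<phi> where "\<phi> = (\<lambda>x. (f x - b) / (f x + cnj b))"
  have zin: "z \<in> cball z r" using \<open>r > 0\<close> by simp
  have b: "Re b > 0" using pos[OF zin] by (simp add: b_def)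
  have nz: "f x + cnj b \<noteq> 0" if "x \<in> cball z r" for x
    using pos[OF that] b by (auto simp: complex_eq_iff)
  have hol: "\<phi> holomorphic_on cball z r"
    unfolding \<phi>_def using f nz by (intro holomorphic_intros) auto
  have le1: "norm (\<phi> x) \<le> 1" if "x \<in> cball z r" for x
  proof -
    have "(norm (f x - b))\<^sup>2 \<le> (norm (f x + cnj b))\<^sup>2"
      using mult_pos_pos[OF pos[OF that] b] unfolding cmod_power2
      by (simp add: power2_eq_square algebra_simps)
    then have "norm (f x - b) \<le> norm (f x + cnj b)"
      by (rule power2_le_imp_le) simp
    then show ?thesis by (simp add: \<phi>_def norm_divide divide_le_eq_1)
  qed
  have "norm ((deriv ^^ 1) \<phi> z) \<le> fact 1 * 1 / r ^ 1"
  proof (rule Cauchy_inequality)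
    show "\<phi> holomorphic_on ball z r"
      using hol by (rule holomorphic_on_subset) auto
    show "continuous_on (cball z r) \<phi>"
      using hol by (rule holomorphic_on_imp_continuous_on)
  qed (use \<open>r > 0\<close> le1 in \<open>auto simp: dist_norm\<close>)
  then have 1: "norm (deriv \<phi> z) \<le> 1 / r" by simp
  have "f holomorphic_on ball z r"
    using f by (rule holomorphic_on_subset) auto
  then have df: "(f has_field_derivative deriv f z) (at z)"
    using \<open>r > 0\<close> by (intro holomorphic_derivI[of f "ball z r"]) auto
  have "(\<phi> has_field_derivative deriv f z / (f z + cnj b)) (at z)"
    unfolding \<phi>_def using nz[OF zin]
    by (auto intro!: derivative_eq_intros df simp: b_def)
  then have "deriv \<phi> z = deriv f z / (f z + cnj b)"
    by (rule DERIV_imp_deriv)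
  moreover have "f z + cnj b = of_real (2 * Re b)"
    by (simp add: b_def complex_eq_iff)
  ultimately have "norm (deriv \<phi> z) = norm (deriv f z) / (2 * Re b)"
    using b by (simp add: norm_divide norm_mult)
  with 1 b \<open>r > 0\<close> show ?thesis
    by (simp add: b_def field_simps)
qed

section \<open>The staircase function\<close>

text \<open>
  The entire function with \<open>S(0) = 0\<close> and \<open>S'(z) = 1 - cos (2 \<pi> \<surd>z)\<close>. The branch of the root is
  immaterial, since only even functions of it occur.
\<close>

definition stair :: "complex \<Rightarrow> complex" where
  "stair z = z - (csqrt z * sin (2 * pi * csqrt z) / pi + (cos (2 * pi * csqrt z) - 1) / (2 * pi\<^sup>2))"

definition stair' :: "complex \<Rightarrow> complex" where
  "stair' z = 1 - cos (2 * pi * csqrt z)"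

lemma csqrt_power2_cases: "csqrt (\<zeta>\<^sup>2) = \<zeta> \<or> csqrt (\<zeta>\<^sup>2) = -\<zeta>"
  using power2_csqrt[of "\<zeta>\<^sup>2"] by (simp only: power2_eq_iff)

lemma stair_power2:
  fixes \<zeta> :: complex
  shows "stair (\<zeta>\<^sup>2) = \<zeta>\<^sup>2 - (\<zeta> * sin (2 * pi * \<zeta>) / pi + (cos (2 * pi * \<zeta>) - 1) / (2 * pi\<^sup>2))"
  using csqrt_power2_cases[of \<zeta>] unfolding stair_def by (elim disjE) simp_all

lemma stair'_power2:
  fixes \<zeta> :: complex
  shows "stair' (\<zeta>\<^sup>2) = 1 - cos (2 * pi * \<zeta>)"
  using csqrt_power2_cases[of \<zeta>] unfolding stair'_def by (elim disjE) simp_all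

text \<open>\<open>csqrt\<close> jumps across the negative real axis, so near a point there the
  branch \<open>\<i> * csqrt (- y)\<close> replaces it. This lets \<open>stair\<close> be
  differentiated at every point but 0.\<close>

lemma local_sqrt:
  assumes "z \<noteq> 0"
  obtains r :: "complex \<Rightarrow> complex" and A where "open A" "z \<in> A" "\<And>y. y \<in> A \<Longrightarrow> (r y)\<^sup>2 = y"
    "\<And>y. y \<in> A \<Longrightarrow> (r has_field_derivative 1 / (2 * r y)) (at y)"
proof (cases "z \<in> \<real>\<^sub>\<le>\<^sub>0")
  case False
  show ?thesis
    by (rule that[of "- \<real>\<^sub>\<le>\<^sub>0" csqrt])
       (use False in \<open>auto intro!: derivative_eq_intros\<close>)
next
  case True
  then have "- z \<notin> \<real>\<^sub>\<le>\<^sub>0"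
    using assms by (auto simp: complex_nonpos_Reals_iff complex_eq_iff)
  show ?thesis
  proof (rule that[of "uminus ` (- \<real>\<^sub>\<le>\<^sub>0)" "\<lambda>y. \<i> * csqrt (- y)"])
    show "open (uminus ` (- \<real>\<^sub>\<le>\<^sub>0 :: complex set))"
      by (intro open_negations) auto
    show "z \<in> uminus ` (- \<real>\<^sub>\<le>\<^sub>0)"
      using \<open>- z \<notin> \<real>\<^sub>\<le>\<^sub>0\<close> by (intro image_eqI[of _ _ "-z"]) auto
  next
    fix y :: complex assume "y \<in> uminus ` (- \<real>\<^sub>\<le>\<^sub>0)"
    then have y: "- y \<notin> \<real>\<^sub>\<le>\<^sub>0" by auto
    then have "csqrt (- y) \<noteq> 0" by auto
    then show "((\<lambda>y. \<i> * csqrt (- y)) has_field_derivative 1 / (2 * (\<i> * csqrt (- y)))) (at y)"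
      using y by (auto intro!: derivative_eq_intros simp: field_simps)
  qed (simp add: power_mult_distrib)
qed

text \<open>By \<open>stair_power2\<close> any local branch \<open>r\<close> of the root gives
  \<open>stair y = ?h (r y)\<close>, where \<open>?h\<close> has derivative 2 \<zeta> (1 - cos (2
  \<pi> \<zeta>)). The chain rule with 2 r r' = 1 removes the factor 2 \<zeta>.\<close>

lemma stair_deriv_nonzero:
  assumes "z \<noteq> 0"
  shows "(stair has_field_derivative stair' z) (at z)"
proof -
  obtain A r where A: "open A" "z \<in> A" "\<And>y. y \<in> A \<Longrightarrow> (r y)\<^sup>2 = y"
    "\<And>y. y \<in> A \<Longrightarrow> (r has_field_derivative 1 / (2 * r y)) (at y)"
    by (rule local_sqrt[OF assms]) (rule that)
  have rz: "r z \<noteq> 0" using A(2) A(3)[of z] assms by auto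
  define r' where "r' = 1 / (2 * r z)"
  have r': "(r has_field_derivative r') (at z)" "2 * r z * r' = 1"
    using A(4)[OF A(2)] rz by (simp_all add: r'_def)
  define p :: complex where "p = pi"
  have p: "p \<noteq> 0" by (simp add: p_def)
  let ?h = "\<lambda>\<zeta>. \<zeta>\<^sup>2 - (\<zeta> * sin (2 * p * \<zeta>) / p + (cos (2 * p * \<zeta>) - 1) / (2 * p\<^sup>2))"
  have h: "(?h has_field_derivative 2 * r z * (1 - cos (2 * p * r z))) (at (r z))"
    using p by (auto intro!: derivative_eq_intros simp: field_simps power2_eq_square)
  have eq: "?h (r y) = stair y" if "y \<in> A" for y
    using stair_power2[of "r y"] A(3)[OF that] by (simp add: p_def)
  have "1 - cos (2 * p * r z) = stair' z"
    using stair'_power2[of "r z"] A(2,3) by (simp add: p_def)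
  then have "2 * r z * (1 - cos (2 * p * r z)) * r' = stair' z"
    using r'(2) by (simp add: mult.assoc mult.left_commute)
  then show ?thesis
    using has_field_derivative_transform_within_open[OF DERIV_chain2[OF h r'(1)] A(1,2) eq] by simp
qed

lemma isCont_csqrt_0: "isCont csqrt 0"
proof -
  have "((\<lambda>z::complex. sqrt (norm z)) \<longlongrightarrow> sqrt (norm (0::complex))) (at 0)"
    by (intro tendsto_intros)
  then have "((\<lambda>z. norm (csqrt z)) \<longlongrightarrow> 0) (at 0)" by simp
  then show ?thesis
    unfolding isCont_def csqrt_0 by (rule tendsto_norm_zero_cancel)
qed

lemma isCont_stair'_0: "isCont stair' 0"
  unfolding stair'_def[abs_def] using isCont_csqrt_0 by (auto intro!: continuous_intros)

lemma continuous_stair: "continuous_on A stair"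
proof -
  have "isCont stair z" for z
  proof (cases "z = 0")
    case True
    have "isCont stair 0"
      unfolding stair_def[abs_def] using isCont_csqrt_0 by (auto intro!: continuous_intros)
    then show ?thesis using True by simp
  next
    case False
    show ?thesis using DERIV_isCont[OF stair_deriv_nonzero[OF False]] .
  qed
  then show ?thesis
    by (simp add: continuous_at_imp_continuous_on)
qed

text \<open>At 0 no holomorphic root exists, but a continuous function has no isolated singularity
  there.\<close>

lemma holomorphic_stair: "stair holomorphic_on A"
proof -
  have "stair field_differentiable at z within UNIV - {0}" if "z \<in> UNIV - {0}" for z
    using that stair_deriv_nonzero[of z]
    by (auto simp: field_differentiable_def intro: has_field_derivative_at_within)
  then have "stair holomorphic_on UNIV - {0}"
    by (rule holomorphic_onI)
  then have 1: "stair holomorphic_on UNIV"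
    using no_isolated_singularity[OF continuous_stair] by simp
  show ?thesis
    using holomorphic_on_subset[OF 1] by simp
qed

lemma deriv_stair: "deriv stair z = stair' z"
proof (cases "z = 0")
  case False
  then show ?thesis using stair_deriv_nonzero by (intro DERIV_imp_deriv)
next
  case True
  have "deriv stair holomorphic_on UNIV" by (intro holomorphic_deriv holomorphic_stair) auto
  then have "continuous_on UNIV (deriv stair)"
    by (rule holomorphic_on_imp_continuous_on)
  then have 1: "(deriv stair \<longlongrightarrow> deriv stair 0) (at 0)"
    by (simp add: continuous_on_def)
  have "(stair' \<longlongrightarrow> stair' 0) (at 0)"
    using isCont_stair'_0 by (simp add: isCont_def)
  moreover have "eventually (\<lambda>y. stair' y = deriv stair y) (at 0)"
    by (simp add: eventually_at_filter DERIV_imp_deriv[OF stair_deriv_nonzero])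
  ultimately have 2: "(deriv stair \<longlongrightarrow> stair' 0) (at 0)"
    by (rule Lim_transform_eventually)
  show ?thesis
    using tendsto_unique[OF _ 1 2] True by simp
qed

lemma has_field_derivative_stair: "(stair has_field_derivative stair' z) (at z)"
  using holomorphic_derivI[OF holomorphic_stair open_UNIV UNIV_I] by (simp only: deriv_stair)

text \<open>\<open>stair\<close> grows exponentially in the root off the positive axis, but only
  together with its derivative: the cosine in \<open>stair\<close> is 1 - \<open>stair'\<close>, and
  the sine is controlled by the cosine through sin^2 = 1 - cos^2.\<close>

lemma norm_stair_le: "norm (stair z) \<le> 5 * (1 + norm z) * (1 + norm (stair' z))"
proof -
  define \<zeta> where "\<zeta> = csqrt z"
  define c s where "c = cos (2 * pi * \<zeta>)" and "s = sin (2 * pi * \<zeta>)"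
  have "norm (s ^ 2) = norm (1 - c ^ 2)"
    by (simp add: c_def s_def sin_squared_eq)
  also have "\<dots> \<le> 1 + norm c ^ 2"
    using norm_triangle_ineq4[of 1 "c^2"] by (simp add: norm_power)
  also have "\<dots> \<le> (1 + norm c) ^ 2"
    by (simp add: power2_eq_square algebra_simps)
  finally have s: "norm s \<le> 1 + norm c"
    by (auto simp: norm_power intro: power2_le_imp_le)
  have D: "stair' z = 1 - c"
    by (simp add: stair'_def c_def \<zeta>_def)
  have c: "norm c \<le> 1 + norm (stair' z)"
    using norm_triangle_ineq4[of 1 "1 - c"] by (simp add: D)
  have "sqrt (norm z) \<le> 1 + norm z"
    by (rule real_le_lsqrt[THEN order_trans[OF _ order_refl]]) (auto simp: power2_eq_square algebra_simps)
  then have \<zeta>: "norm \<zeta> \<le> 1 + norm z"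
    by (simp add: \<zeta>_def)
  have "norm (stair z) \<le> norm z + (norm (\<zeta> * s / pi) + norm ((c - 1) / (2 * pi\<^sup>2)))"
    unfolding stair_def c_def s_def \<zeta>_def
    by (rule order_trans[OF norm_triangle_ineq4 add_left_mono[OF norm_triangle_ineq]])
  also have "norm (\<zeta> * s / pi) \<le> norm \<zeta> * norm s / 1"
    unfolding norm_divide norm_mult using pi_ge_two by (intro frac_le) auto
  also have "norm \<zeta> * norm s / 1 \<le> (1 + norm z) * (2 + norm (stair' z))"
    using \<zeta> s c by (simp add: mult_mono)
  also have "norm ((c - 1) / (2 * pi\<^sup>2)) \<le> norm (stair' z) / 1"
  proof -
    have "1 * 1 \<le> pi * pi" using pi_ge_two by (intro mult_mono) auto
    then have "1 \<le> 2 * pi\<^sup>2" by (simp add: power2_eq_square)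
    moreover have "norm ((c - 1) / (2 * pi\<^sup>2)) = norm (stair' z) / (2 * pi\<^sup>2)"
      by (simp add: D norm_divide norm_mult norm_power norm_minus_commute)
    ultimately show ?thesis by (simp add: divide_le_eq mult_le_cancel_left1)
  qed
  also have "norm z + ((1 + norm z) * (2 + norm (stair' z)) + norm (stair' z) / 1)
      \<le> 5 * (1 + norm z) * (1 + norm (stair' z))"
    by (simp add: algebra_simps)
  finally show ?thesis by simp
qed

text \<open>This turns - S(w)^4 / 4 into a damping term in the real part of \<open>phase\<close>. A
  bounded derivative bounds the cosine of 2 \<pi> \<zeta>, which confines the root \<zeta> to a
  strip around the real axis.\<close>

lemma Re_stair_power4:
  assumes "norm (stair' z) \<le> 1"
  shows "Re (stair z ^ 4) \<ge> norm (stair z) ^ 4 / 2 - 2 * 500 ^ 4"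
proof -
  define \<zeta> where "\<zeta> = csqrt z"
  define a b where "a = Re \<zeta>" and "b = Im \<zeta>"
  define c s where "c = cos (2 * pi * \<zeta>)" and "s = sin (2 * pi * \<zeta>)"
  have c: "norm c \<le> 2"
    using norm_triangle_ineq4[of 1 "1 - c"] assms by (simp add: stair'_def c_def \<zeta>_def)
  have "norm (s ^ 2) = norm (1 - c ^ 2)"
    by (simp add: c_def s_def sin_squared_eq)
  also have "\<dots> \<le> 1 + norm c ^ 2"
    using norm_triangle_ineq4[of 1 "c^2"] by (simp add: norm_power)
  also have "\<dots> \<le> 3 ^ 2"
    using power_mono[OF c, of 2] by simp
  finally have s: "norm s \<le> 3"
    by (auto simp: norm_power intro: power2_le_imp_le)
  \<comment> \<open>|t| \<le> |sinh t|, and the modulus of the cosine is at least |sinh| of the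
    imaginary part.\<close>
  have "(2 * pi * b)\<^sup>2 \<le> ((exp (2 * pi * b) - inverse (exp (2 * pi * b))) / 2)\<^sup>2"
    using real_le_abs_sinh[of "2 * pi * b"] by (simp only: abs_le_square_iff)
  also have "\<dots> \<le> (norm c)\<^sup>2"
    unfolding c_def norm_cos_squared by (simp add: b_def power_divide)
  also have "\<dots> \<le> 2\<^sup>2" using c by (rule power_mono) simp
  finally have "\<bar>2 * pi * b\<bar> \<le> \<bar>2\<bar>" by (simp only: abs_le_square_iff)
  moreover have "2 * \<bar>b\<bar> \<le> 2 * pi * \<bar>b\<bar>"
    using pi_ge_two by (intro mult_right_mono) auto
  ultimately have b: "\<bar>b\<bar> \<le> 1" by (simp add: abs_mult)
  define e where "e = \<zeta> * s / pi + (c - 1) / (2 * pi\<^sup>2)"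
  have S: "stair z = \<zeta>\<^sup>2 - e"
    by (simp add: stair_def e_def c_def s_def \<zeta>_def)
  have "norm e \<le> norm (\<zeta> * s / pi) + norm ((c - 1) / (2 * pi\<^sup>2))"
    unfolding e_def by (rule norm_triangle_ineq)
  also have "norm (\<zeta> * s / pi) \<le> norm \<zeta> * 3 / 3"
    unfolding norm_divide norm_mult using pi_gt3 s by (intro frac_le mult_left_mono) auto
  also have "norm ((c - 1) / (2 * pi\<^sup>2)) \<le> 3 / 3"
  proof -
    have "3 * 3 \<le> pi * pi" using pi_gt3 by (intro mult_mono) auto
    then have "3 \<le> 2 * pi\<^sup>2" by (simp add: power2_eq_square)
    moreover have "norm (c - 1) \<le> 3"
      using norm_triangle_ineq4[of c 1] c by simp
    ultimately show ?thesis
      unfolding norm_divide norm_mult norm_power norm_of_real by (intro frac_le) auto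
  qed
  finally have e: "norm e \<le> norm \<zeta> + 1" by simp
  have "norm \<zeta> \<le> \<bar>a\<bar> + 1"
    using cmod_le[of \<zeta>] b by (simp add: a_def b_def)
  then have e: "\<bar>Re e\<bar> \<le> \<bar>a\<bar> + 2" "\<bar>Im e\<bar> \<le> \<bar>a\<bar> + 2"
    using e abs_Re_le_cmod[of e] abs_Im_le_cmod[of e] by auto
  define X Y where "X = Re (stair z)" and "Y = Im (stair z)"
  have X: "X = a\<^sup>2 - b\<^sup>2 - Re e" and Y: "Y = 2 * (a * b) - Im e"
    by (simp_all add: X_def Y_def S a_def b_def power2_eq_square)
  have b2: "b\<^sup>2 \<le> 1" using b by (simp add: abs_square_le_1)
  have ab: "\<bar>a * b\<bar> \<le> \<bar>a\<bar>"
    using b by (simp add: abs_mult mult_left_le)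
  have Xe: "\<bar>X - a\<^sup>2\<bar> \<le> \<bar>a\<bar> + 3"
    using X b2 e(1) zero_le_power2[of b] by linarith
  have Ye: "\<bar>Y\<bar> \<le> 3 * \<bar>a\<bar> + 2"
    using Y ab e(2) by linarith
  have norm4: "norm (stair z) ^ 4 = (X\<^sup>2 + Y\<^sup>2)\<^sup>2"
  proof -
    have "norm (stair z) ^ 4 = ((norm (stair z))\<^sup>2)\<^sup>2" by simp
    then show ?thesis by (simp only: cmod_power2 X_def Y_def)
  qed
  have Re4: "Re (stair z ^ 4) = X ^ 4 - 6 * X\<^sup>2 * Y\<^sup>2 + Y ^ 4"
  proof -
    have "stair z ^ 4 = (stair z)\<^sup>2 * (stair z)\<^sup>2" by (simp flip: power_add)
    then show ?thesis
      by (simp add: X_def Y_def power2_eq_square algebra_simps power4_eq_xxxx)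
  qed
  \<comment> \<open>\<open>stair z\<close> lies in a parabolic neighbourhood of the positive real axis, so its argument is
    small when \<open>z\<close> is large.\<close>
  show ?thesis
  proof (cases "\<bar>a\<bar> \<ge> 20")
    case True
    have "20 * \<bar>a\<bar> \<le> \<bar>a\<bar> * \<bar>a\<bar>" using True by (intro mult_right_mono) auto
    then have "20 * \<bar>a\<bar> \<le> a\<^sup>2" by (simp add: power2_eq_square)
    \<comment> \<open>The claim amounts to 14 X^2 Y^2 \<le> X^4 + Y^4, for which the ratio 4
      suffices.\<close>
    then have "4 * \<bar>Y\<bar> \<le> X" using Xe Ye True by linarith
    then have "(4 * \<bar>Y\<bar>)\<^sup>2 \<le> X\<^sup>2" by (intro power_mono) auto
    then have "16 * Y\<^sup>2 \<le> X\<^sup>2" by (simp add: power_mult_distrib)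
    then have "X\<^sup>2 * (16 * Y\<^sup>2) \<le> X\<^sup>2 * X\<^sup>2" by (intro mult_left_mono) auto
    then have "X\<^sup>2 * Y\<^sup>2 * 16 \<le> X ^ 4" by (simp add: power2_eq_square power4_eq_xxxx)
    moreover have "0 \<le> Y ^ 4" "0 \<le> X\<^sup>2 * Y\<^sup>2" by auto
    moreover have "(X\<^sup>2 + Y\<^sup>2)\<^sup>2 = X ^ 4 + 2 * (X\<^sup>2 * Y\<^sup>2) + Y ^ 4"
      by (simp add: power2_sum)
    ultimately have "(X\<^sup>2 + Y\<^sup>2)\<^sup>2 / 2 \<le> X ^ 4 - 6 * X\<^sup>2 * Y\<^sup>2 + Y ^ 4"
      by linarith
    then show ?thesis by (simp add: norm4 Re4)
  next
    case False
    \<comment> \<open>For small roots the sign of the real part is unknown, but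
      \<open>stair z\<close> is bounded by 500, and the additive constant absorbs the loss of 3/2
      |S|^4.\<close>
    then have "\<bar>a\<bar> ^ 2 \<le> 20 ^ 2" by (intro power_mono) auto
    then have "a\<^sup>2 \<le> 400" by simp
    then have "\<bar>X\<bar> + \<bar>Y\<bar> \<le> 500"
      using Xe Ye False zero_le_power2[of a] by linarith
    then have "norm (stair z) \<le> 500"
      using cmod_le[of "stair z"] by (simp add: X_def Y_def)
    then have "norm (stair z) ^ 4 \<le> 500 ^ 4" by (intro power_mono) auto
    moreover have "\<bar>Re (stair z ^ 4)\<bar> \<le> norm (stair z) ^ 4"
      using abs_Re_le_cmod[of "stair z ^ 4"] by (simp add: norm_power)
    ultimately show ?thesis by linarith
  qed
qed

text \<open>S'(z) = 2 sin^2 (\<pi> \<zeta>) vanishes only at squares of integers, and its modulus is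
  at least a multiple of b^2, where \<zeta> = a + ib. Since Im z = 2ab and a^2 \<le> |z|, a point
  off the real axis has b^2 of order at least 1/|z|.\<close>

lemma norm_stair'_ge:
  assumes "\<bar>Im z\<bar> \<ge> 1 / 4"
  shows "1 / 4 \<le> norm (stair' z) * norm z"
proof -
  define \<zeta> where "\<zeta> = csqrt z"
  define a b where "a = Re \<zeta>" and "b = Im \<zeta>"
  have z: "z = \<zeta>\<^sup>2" by (simp add: \<zeta>_def)
  have "stair' z = 1 - cos (2 * (pi * \<zeta>))"
    unfolding z stair'_power2 by (simp add: mult.assoc)
  then have D: "stair' z = 2 * (sin (pi * \<zeta>))\<^sup>2"
    unfolding cos_double_sin by simp
  have "(pi * b)\<^sup>2 \<le> ((exp (pi * b) - inverse (exp (pi * b))) / 2)\<^sup>2"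
    using real_le_abs_sinh[of "pi * b"] by (simp only: abs_le_square_iff)
  also have "\<dots> = (exp (2 * (pi * b)) + inverse (exp (2 * (pi * b))) - 2) / 4"
    unfolding exp_double by (simp add: power2_eq_square field_simps)
  also have "\<dots> \<le> (norm (sin (pi * \<zeta>)))\<^sup>2"
    unfolding norm_sin_squared by (simp add: b_def)
  finally have "2 * (pi * b)\<^sup>2 \<le> norm (stair' z)"
    by (simp add: D norm_mult norm_power)
  moreover have "9 * b\<^sup>2 \<le> (pi * b)\<^sup>2"
    using pi_gt3 power_mono[of 3 pi 2] by (simp add: power_mult_distrib mult_right_mono)
  ultimately have 1: "18 * b\<^sup>2 \<le> norm (stair' z)" by simp
  have "(1 / 4)\<^sup>2 \<le> (Im z)\<^sup>2"
    using assms power_mono[of "1/4" "\<bar>Im z\<bar>" 2] by simp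
  also have "\<dots> = 4 * b\<^sup>2 * a\<^sup>2"
    by (simp add: z a_def b_def power2_eq_square)
  also have "\<dots> \<le> 4 * b\<^sup>2 * norm z"
    by (intro mult_left_mono) (auto simp: z norm_power cmod_power2 a_def)
  finally have "1 / 4 \<le> 18 * b\<^sup>2 * norm z" by (simp add: power2_eq_square)
  also have "\<dots> \<le> norm (stair' z) * norm z"
    using 1 by (intro mult_right_mono) auto
  finally show ?thesis .
qed

lemma norm_sin_le: "norm (sin w) \<le> exp (norm w) * norm (w :: complex)"
proof -
  have "norm (sin w - sin 0) \<le> exp (norm w) * norm (w - 0)"
  proof (rule field_differentiable_bound[of "cball 0 (norm w)"])
    fix x :: complex assume "x \<in> cball 0 (norm w)"
    then show "norm (cos x) \<le> exp (norm w)"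
      using norm_cos_le[of x] by (simp add: order_trans)
  qed (auto intro!: derivative_eq_intros)
  then show ?thesis by simp
qed

lemma sin_cos_2pi_nat:
  "sin (2 * complex_of_real pi * of_nat k) = 0" "cos (2 * complex_of_real pi * of_nat k) = 1"
proof -
  have 1: "2 * complex_of_real pi * of_nat k = of_real (2 * real k * pi)" by simp
  show "sin (2 * complex_of_real pi * of_nat k) = 0" "cos (2 * complex_of_real pi * of_nat k) = 1"
    unfolding 1 sin_of_real cos_of_real by (simp_all only: sin_2npi cos_2npi of_real_0 of_real_1)
qed

lemma stair_square: "stair ((of_nat k)\<^sup>2) = (of_nat k)\<^sup>2"
  unfolding stair_power2 by (simp add: sin_cos_2pi_nat)

text \<open>By periodicity S'(z) = 2 sin^2 (\<pi> v) with v = \<zeta> - k, and v is O(1/k) because v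
  (\<zeta> + k) = z - k^2.\<close>

lemma norm_stair'_near_square:
  assumes "k \<ge> 1" "norm (z - (of_nat k)\<^sup>2) \<le> 1"
  shows "norm (stair' z) \<le> 32 * exp 8 / (real k)\<^sup>2"
proof -
  define \<zeta> where "\<zeta> = csqrt z"
  define v where "v = \<zeta> - of_nat k"
  have "2 * pi * \<zeta> = 2 * (pi * v) + 2 * complex_of_real pi * of_nat k"
    by (simp add: v_def algebra_simps)
  then have "cos (2 * pi * \<zeta>) = cos (2 * (pi * v))"
    by (simp only: cos_add sin_cos_2pi_nat) simp
  then have D: "stair' z = 2 * (sin (pi * v))\<^sup>2"
    unfolding cos_double_sin by (simp add: stair'_def \<zeta>_def)
  \<comment> \<open>The principal branch matters here: Re \<zeta> \<ge> 0 keeps \<zeta> + k at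
    distance at least k from 0.\<close>
  have "Re \<zeta> \<ge> 0" using csqrt_principal[of z] by (auto simp: \<zeta>_def)
  then have "real k \<le> norm (\<zeta> + of_nat k)"
    using complex_Re_le_cmod[of "\<zeta> + of_nat k"] by simp
  then have "norm v * real k \<le> norm v * norm (\<zeta> + of_nat k)"
    by (intro mult_left_mono) auto
  also have "\<dots> = norm (z - (of_nat k)\<^sup>2)"
    by (simp add: v_def \<zeta>_def norm_mult[symmetric] algebra_simps flip: power2_eq_square)
  finally have "norm v * real k \<le> 1" using assms by simp
  then have v: "norm v \<le> 1 / real k" using assms by (simp add: field_simps)
  have "norm (pi * v) \<le> 4 * (1 / real k)"
    unfolding norm_mult using pi_less_4 v by (intro mult_mono) auto
  moreover have "4 * (1 / real k) \<le> 4" using assms by (simp add: divide_le_eq)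
  ultimately have "exp (norm (pi * v)) * norm (pi * v) \<le> exp 4 * (4 * (1 / real k))"
    by (intro mult_mono) auto
  then have "norm (sin (pi * v)) \<le> exp 4 * (4 * (1 / real k))"
    using norm_sin_le[of "pi * v"] by linarith
  then have "norm (sin (pi * v)) ^ 2 \<le> (exp 4 * (4 * (1 / real k))) ^ 2"
    by (intro power_mono) auto
  also have "\<dots> = 16 * exp 8 / (real k)\<^sup>2"
    by (simp add: power_mult_distrib power_divide flip: exp_of_nat_mult exp_double)
  finally show ?thesis
    by (simp add: D norm_mult norm_power)
qed

text \<open>The mean value inequality, starting from the fixed point k^2 of
  \<open>stair\<close>.\<close>

lemma stair_near_square:
  assumes "k \<ge> 1" "norm (z - (of_nat k)\<^sup>2) \<le> 1"
  shows "norm (stair z - (of_nat k)\<^sup>2) \<le> 32 * exp 8 / (real k)\<^sup>2"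
proof -
  have "norm (stair z - stair ((of_nat k)\<^sup>2)) \<le> 32 * exp 8 / (real k)\<^sup>2 * norm (z - (of_nat k)\<^sup>2)"
  proof (rule field_differentiable_bound[of "cball ((of_nat k)\<^sup>2) 1"])
    fix x :: complex assume "x \<in> cball ((of_nat k)\<^sup>2) 1"
    then show "norm (stair' x) \<le> 32 * exp 8 / (real k)\<^sup>2"
      using assms by (intro norm_stair'_near_square) (auto simp: dist_norm norm_minus_commute)
  qed (use assms in \<open>auto intro: has_field_derivative_at_within has_field_derivative_stair simp: dist_norm norm_minus_commute\<close>)
  also have "\<dots> \<le> 32 * exp 8 / (real k)\<^sup>2 * 1"
    using assms by (intro mult_left_mono) auto
  finally show ?thesis by (simp add: stair_square)
qed

section \<open>The phase and its growth\<close>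

definition phase :: "complex \<Rightarrow> complex \<Rightarrow> complex" where
  "phase z w = stair z * stair w - stair w ^ 4 / 4"

text \<open>With t = k^2 the values S(z), S(w) are t^3 + a and t + b, where a = O(t^-3) and b =
  O(t^-1). The only term too large to be bounded, t^3 b, cancels because S(w) = t is critical for
  t^3 S(w) - S(w)^4 / 4.\<close>

lemma phase_near_squares:
  assumes "k \<ge> 1" "norm (z - (of_nat k) ^ 6) \<le> 1" "norm (w - (of_nat k)\<^sup>2) \<le> 1"
  shows "norm (phase z w - 3 / 4 * of_nat k ^ 8) \<le> 5 * (32 * exp 8) ^ 4"
proof -
  define C :: real where "C = 32 * exp 8"
  define t :: complex where "t = (of_nat k)\<^sup>2"
  define \<tau> where "\<tau> = (real k)\<^sup>2"
  have \<tau>: "\<tau> \<ge> 1" "norm t = \<tau>" using assms by (simp_all add: \<tau>_def t_def norm_power)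
  have "1 * 1 \<le> 32 * exp (8::real)" by (intro mult_mono) auto
  then have C: "C \<ge> 1" by (simp add: C_def)
  define a b where "a = stair z - t ^ 3" and "b = stair w - t"
  \<comment> \<open>k^6 is the square of k^3, so the estimate at squares applies with index
    k^3.\<close>
  have "norm (stair z - (of_nat (k ^ 3))\<^sup>2) \<le> C / (real (k ^ 3))\<^sup>2"
    unfolding C_def using assms by (intro stair_near_square) (auto simp flip: power_mult)
  then have "norm a \<le> C / \<tau> ^ 3"
    by (simp add: a_def t_def \<tau>_def flip: power_mult)
  then have "norm a * \<tau> ^ 3 \<le> C" using \<tau> by (simp add: field_simps)
  moreover have "norm a * \<tau> \<le> norm a * \<tau> ^ 3" "norm a * 1 \<le> norm a * \<tau> ^ 3"
    using \<tau>(1) power_increasing[of 1 3 \<tau>] one_le_power[of \<tau> 3] by (intro mult_left_mono; simp)+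
  ultimately have a: "norm a * \<tau> \<le> C" "norm a \<le> C" by auto
  have "norm b \<le> C / \<tau>"
    using stair_near_square[OF assms(1,3)] by (simp add: b_def t_def \<tau>_def C_def)
  then have b: "norm b * \<tau> \<le> C" using \<tau> by (simp add: field_simps)
  moreover have "norm b * 1 \<le> norm b * \<tau>" using \<tau> by (intro mult_left_mono) auto
  ultimately have b': "norm b \<le> C" by simp
  have "phase z w - 3 / 4 * of_nat k ^ 8 = phase z w - 3 / 4 * t ^ 4"
    by (simp add: t_def flip: power_mult)
  also have "\<dots> = (a + t ^ 3) * (b + t) - (b + t) ^ 4 / 4 - 3 / 4 * t ^ 4"
    by (simp add: phase_def a_def b_def)
  also have "\<dots> = a * t + a * b - 3 / 2 * (b * t)\<^sup>2 - (b * t) * b\<^sup>2 - b ^ 4 / 4"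
    by (simp add: algebra_simps power4_eq_xxxx power3_eq_cube power2_eq_square)
  also have "norm \<dots> \<le> norm (a * t) + norm (a * b) + norm (3 / 2 * (b * t)\<^sup>2) + norm ((b * t) * b\<^sup>2) + norm (b ^ 4 / 4)"
    by (intro order_trans[OF norm_triangle_ineq4] order_trans[OF norm_triangle_ineq] add_mono order_refl)
  also have "\<dots> \<le> C + C * C + 3 / 2 * C\<^sup>2 + C * C\<^sup>2 + C ^ 4 / 4"
    unfolding norm_mult norm_divide norm_power \<tau>(2) using a b b' \<tau> C
    by (intro add_mono mult_mono power_mono divide_right_mono) auto
  also have "\<dots> \<le> C ^ 4 + C ^ 4 + 3 / 2 * C ^ 4 + C ^ 4 + C ^ 4 / 4"
  proof -
    have "C ^ 1 \<le> C ^ 4" "C ^ 2 \<le> C ^ 4" "C ^ 3 \<le> C ^ 4"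
      using C by (intro power_increasing; simp)+
    then show ?thesis by (simp add: power2_eq_square power3_eq_cube)
  qed
  also have "\<dots> \<le> 5 * C ^ 4" using C by simp
  finally show ?thesis by (simp add: C_def)
qed

text \<open>The two hypotheses bound the partial derivatives of \<open>phase\<close>, as
  \<open>osc_large\<close> supplies them. The cases distinguish whether S'(z) and S'(w) have modulus
  at least 1.\<close>

lemma Re_phase_le:
  fixes C0 :: real
  assumes "C0 \<ge> 0"
  obtains C where "C > 0"
    "\<And>z w. norm (stair' z) * norm (stair w) \<le> C0 \<Longrightarrow> norm (stair' w) * norm (stair z - stair w ^ 3) \<le> C0
      \<Longrightarrow> Re (phase z w) \<le> C * (1 + norm z) powr (4 / 3)"
proof -
  \<comment> \<open>\<open>B\<close> is chosen so that \<open>q \<le> B * \<rho>\<close> below;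
    \<open>C\<close> collects the constants of all cases.\<close>
  define B where "B = 11 + C0"
  define C where "C = 10 * C0 + C0 ^ 4 + (2 + 500 ^ 4) * B powr (4 / 3)"
  have B: "B \<ge> 1" using assms by (simp add: B_def)
  have "C > 0" using assms B by (simp add: C_def add_nonneg_pos)
  have "Re (phase z w) \<le> C * (1 + norm z) powr (4 / 3)"
    if 1: "norm (stair' z) * norm (stair w) \<le> C0"
      and 2: "norm (stair' w) * norm (stair z - stair w ^ 3) \<le> C0" for z w
  proof -
    define \<rho> where "\<rho> = 1 + norm z"
    have \<rho>: "\<rho> \<ge> 1" by (simp add: \<rho>_def)
    have \<rho>43: "\<rho> \<le> \<rho> powr (4 / 3)" using \<rho> powr_mono[of 1 "4 / 3" \<rho>] by simp
    define x where "x = norm (stair w)"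
    have x: "x \<ge> 0" by (simp add: x_def)
    have Re1: "Re (stair z * stair w) \<le> norm (stair z) * x"
      using complex_Re_le_cmod[of "stair z * stair w"] by (simp add: norm_mult x_def)
    have Re2: "- (Re (stair w ^ 4) / 4) \<le> x ^ 4 / 4"
      using abs_Re_le_cmod[of "stair w ^ 4"] by (simp add: norm_power x_def)
    have Re_phase: "Re (phase z w) = Re (stair z * stair w) - Re (stair w ^ 4) / 4"
      by (simp add: phase_def)
    show ?thesis
    proof (cases "norm (stair' z) \<ge> 1")
      case True
      \<comment> \<open>Here S(w) is bounded. S(z) may be huge, but no more than |z| times S'(z),
        and S'(z) S(w) is bounded.\<close>
      have "1 * x \<le> norm (stair' z) * x" using True x by (intro mult_right_mono) auto
      then have xC: "x \<le> C0" using 1 by (simp add: x_def)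
      have "norm (stair z) * x \<le> 5 * \<rho> * (1 + norm (stair' z)) * x"
        using norm_stair_le[of z] x by (intro mult_right_mono) (auto simp: \<rho>_def)
      also have "\<dots> = 5 * \<rho> * (x + norm (stair' z) * x)" by (simp add: algebra_simps)
      also have "\<dots> \<le> 5 * \<rho> * (C0 + C0)"
        using 1 xC \<rho> by (intro mult_left_mono add_mono) (auto simp: x_def)
      also have "\<dots> = 10 * C0 * \<rho>" by simp
      finally have "Re (phase z w) \<le> 10 * C0 * \<rho> + x ^ 4 / 4"
        using Re1 Re2 Re_phase by linarith
      also have "x ^ 4 / 4 \<le> C0 ^ 4 * 1"
        using power_mono[OF xC x, of 4] zero_le_power[OF assms, of 4] by linarith
      also have "C0 ^ 4 * 1 \<le> C0 ^ 4 * \<rho>" using \<rho> assms by (intro mult_left_mono) auto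
      also have "10 * C0 * \<rho> + C0 ^ 4 * \<rho> = (10 * C0 + C0 ^ 4) * \<rho>" by (simp add: algebra_simps)
      also have "\<dots> \<le> C * \<rho> powr (4 / 3)"
        using \<rho>43 \<rho> assms B by (intro mult_mono) (auto simp: C_def)
      finally show ?thesis by (simp add: \<rho>_def)
    next
      case False
      \<comment> \<open>\<open>q\<close> dominates |S(z)| + C0 when |S'(z)| < 1, and the cube root
        \<open>y\<close> is the scale on which S(w) balances S(z) = S(w)^3.\<close>
      define q where "q = 10 * \<rho> + C0 + 1"
      define y where "y = q powr (1 / 3)"
      have q: "q \<ge> 1" using \<rho> assms by (simp add: q_def)
      have y: "y \<ge> 1" "y ^ 3 = q" "y ^ 4 = q powr (4 / 3)"
        using q by (simp_all add: y_def ge_one_powr_ge_zero powr_power)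
      have qy: "q * y = y ^ 4" using y(2) by (simp add: power4_eq_xxxx power3_eq_cube)
      have "norm (stair z) \<le> 5 * \<rho> * (1 + norm (stair' z))"
        using norm_stair_le[of z] by (simp add: \<rho>_def)
      also have "\<dots> \<le> 5 * \<rho> * 2" using False \<rho> by (intro mult_left_mono) auto
      finally have Sz: "norm (stair z) \<le> 10 * \<rho>" by simp
      then have "norm (stair z) * x \<le> q * x"
        using x assms by (intro mult_right_mono) (auto simp: q_def)
      then have Re1': "Re (stair z * stair w) \<le> q * x" using Re1 by simp
      have "Re (phase z w) \<le> (2 + 500 ^ 4) * y ^ 4"
      proof (cases "norm (stair' w) \<ge> 1")
        case True
        have "1 * norm (stair z - stair w ^ 3) \<le> norm (stair' w) * norm (stair z - stair w ^ 3)"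
          using True by (intro mult_right_mono) auto
        then have "norm (stair z - stair w ^ 3) \<le> C0" using 2 by simp
        then have "x ^ 3 \<le> y ^ 3"
          using Sz norm_triangle_ineq3[of "stair w ^ 3" "stair z"] y(2)
          by (simp add: q_def x_def norm_power norm_minus_commute)
        then have xy: "x \<le> y" by (rule power_le_imp_le_base[of _ 2, simplified]) (use y in auto)
        have "q * x \<le> q * y" using xy q by (intro mult_left_mono) auto
        moreover have "x ^ 4 \<le> y ^ 4" using xy x by (intro power_mono) auto
        ultimately have "Re (phase z w) \<le> 2 * y ^ 4"
          using Re1' Re2 Re_phase qy zero_le_power[OF x, of 4] by linarith
        also have "\<dots> \<le> (2 + 500 ^ 4) * y ^ 4" using y(1) by (intro mult_right_mono) auto
        finally show ?thesis .
      next
        case False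
        then have "Re (stair w ^ 4) \<ge> x ^ 4 / 2 - 2 * 500 ^ 4"
          using Re_stair_power4[of w] by (simp add: x_def)
        then have R: "Re (phase z w) \<le> q * x - x ^ 4 / 8 + 500 ^ 4"
          using Re1' Re_phase by simp
        \<comment> \<open>Up to x = 2y the linear term is small enough by itself; beyond it x^3
          \<ge> 8q, so the quartic term wins.\<close>
        have "q * x - x ^ 4 / 8 \<le> 2 * (q * y)"
        proof (cases "x \<le> 2 * y")
          case True
          then have "q * x \<le> q * (2 * y)" using q by (intro mult_left_mono) auto
          moreover have "q * (2 * y) = 2 * (q * y)" by simp
          ultimately show ?thesis using zero_le_power[OF x, of 4] by linarith
        next
          case False
          then have "(2 * y) ^ 3 \<le> x ^ 3" using y by (intro power_mono) auto
          then have "8 * q \<le> x ^ 3" using y(2) by (simp add: power_mult_distrib)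
          then have "8 * q * x \<le> x ^ 3 * x" using x by (intro mult_right_mono) auto
          then have "q * x \<le> x ^ 4 / 8" by (simp add: power4_eq_xxxx power3_eq_cube)
          moreover have "0 \<le> q * y" using q y by simp
          ultimately show ?thesis by linarith
        qed
        moreover have "1 \<le> y ^ 4" using y(1) by (rule one_le_power)
        ultimately show ?thesis using R qy by (simp add: algebra_simps)
      qed
      also have "y ^ 4 \<le> (B * \<rho>) powr (4 / 3)"
      proof -
        have "C0 * 1 \<le> C0 * \<rho>" using \<rho> assms by (intro mult_left_mono) auto
        then have "q \<le> B * \<rho>" using \<rho> by (simp add: q_def B_def algebra_simps)
        then show ?thesis unfolding y(3) using q by (intro powr_mono2) auto
      qed
      also have "(2 + 500 ^ 4) * (B * \<rho>) powr (4 / 3) = ((2 + 500 ^ 4) * B powr (4 / 3)) * \<rho> powr (4 / 3)"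
        using B \<rho> by (simp add: powr_mult)
      also have "\<dots> \<le> C * \<rho> powr (4 / 3)"
        using assms by (intro mult_right_mono) (auto simp: C_def)
      finally show ?thesis by (simp add: \<rho>_def)
    qed
  qed
  with \<open>C > 0\<close> show ?thesis by (rule that)
qed

section \<open>Size of the harmonic function on polydiscs\<close>

definition wave :: "real \<Rightarrow> complex \<Rightarrow> complex \<Rightarrow> complex" where
  "wave \<epsilon> z w = exp (\<epsilon> * phase z w)"

lemma has_field_derivative_wave:
  shows "((\<lambda>z. wave \<epsilon> z w) has_field_derivative wave \<epsilon> z w * (\<epsilon> * (stair' z * stair w))) (at z)"
    and "((\<lambda>w. wave \<epsilon> z w) has_field_derivative
            wave \<epsilon> z w * (\<epsilon> * (stair' w * (stair z - stair w ^ 3)))) (at w)"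
  unfolding wave_def phase_def
  by (auto intro!: derivative_eq_intros has_field_derivative_stair simp: algebra_simps power4_eq_xxxx power3_eq_cube)

lemma holomorphic_wave:
  shows "(\<lambda>z. wave \<epsilon> z w) holomorphic_on A" and "wave \<epsilon> z holomorphic_on A"
  unfolding wave_def[abs_def] phase_def
  by (auto intro!: holomorphic_intros holomorphic_on_subset[OF holomorphic_stair])

lemma norm_wave: "norm (wave \<epsilon> z w) = exp (\<epsilon> * Re (phase z w))"
  by (simp add: wave_def)

text \<open>The summand 2 keeps the function away from 0 where \<open>wave\<close> is tiny;
  conversely, where \<open>osc\<close> is near 0, \<open>wave\<close> has modulus at least
  1.\<close>

definition osc :: "real \<Rightarrow> complex \<Rightarrow> complex \<Rightarrow> real" where
  "osc \<epsilon> z w = 2 + Re (wave \<epsilon> z w)"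

lemma continuous_on_osc: "continuous_on A (\<lambda>(z, w). osc \<epsilon> z w)"
proof -
  have "continuous_on A (\<lambda>p. stair (fst p))" "continuous_on A (\<lambda>p. stair (snd p))"
    for A :: "(complex \<times> complex) set"
    by (rule continuous_on_compose2[OF continuous_stair _ subset_refl]; intro continuous_intros)+
  then show ?thesis
    unfolding osc_def wave_def phase_def case_prod_beta by (intro continuous_intros) auto
qed

text \<open>
  Where \<open>osc\<close> is large without zeros, \<open>\<plusminus> wave\<close> maps into the right half-plane, and the gradient
  estimate \<open>norm_deriv_le_Re\<close> then bounds the logarithmic derivatives of \<open>wave\<close>.
\<close>

lemma osc_large:
  assumes \<epsilon>: "\<epsilon> > 0" and "r > 0" and M: "exp M \<ge> 3"
    and large: "\<And>z w. norm (z - z0) \<le> r \<Longrightarrow> norm (w - w0) \<le> r \<Longrightarrow> \<sigma> * osc \<epsilon> z w > exp M"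
    and \<sigma>: "\<sigma> = 1 \<or> \<sigma> = -1"
  shows "norm (stair' z0) * norm (stair w0) \<le> 2 / (r * \<epsilon>)"
    and "norm (stair' w0) * norm (stair z0 - stair w0 ^ 3) \<le> 2 / (r * \<epsilon>)"
    and "exp M \<le> norm (wave \<epsilon> z0 w0) + 2"
proof -
  have Re_pos: "Re (\<sigma> * wave \<epsilon> z w) > exp M - 2"
    if "norm (z - z0) \<le> r" "norm (w - w0) \<le> r" for z w
    using large[OF that] \<sigma> by (auto simp: osc_def)
  then have pos: "0 < \<sigma> * Re (wave \<epsilon> z w)"
    if "norm (z - z0) \<le> r" "norm (w - w0) \<le> r" for z w
    using M that by fastforce
  have Re_le: "Re (\<sigma> * wave \<epsilon> z0 w0) \<le> norm (wave \<epsilon> z0 w0)"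
    using complex_Re_le_cmod[of "\<sigma> * wave \<epsilon> z0 w0"] \<sigma> by (auto simp: norm_mult)
  have nz: "norm (wave \<epsilon> z0 w0) > 0" by (simp add: wave_def)
  \<comment> \<open>The derivative is \<open>wave\<close> times its logarithmic derivative, and the
    real part on the right is at most |wave|, so |wave| cancels.\<close>
  have "norm (deriv (\<lambda>z. \<sigma> * wave \<epsilon> z w0) z0) * r \<le> 2 * Re (\<sigma> * wave \<epsilon> z0 w0)"
    using \<open>r > 0\<close> M by (intro norm_deriv_le_Re holomorphic_intros holomorphic_wave)
       (auto intro!: pos simp: dist_norm norm_minus_commute)
  also have "deriv (\<lambda>z. \<sigma> * wave \<epsilon> z w0) z0 = \<sigma> * (wave \<epsilon> z0 w0 * (\<epsilon> * (stair' z0 * stair w0)))"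
    by (intro DERIV_imp_deriv DERIV_cmult has_field_derivative_wave)
  finally have "norm (wave \<epsilon> z0 w0) * (\<epsilon> * (norm (stair' z0) * norm (stair w0)) * r) \<le> norm (wave \<epsilon> z0 w0) * 2"
    using \<sigma> \<epsilon> Re_le by (auto simp: norm_mult mult_ac)
  then show "norm (stair' z0) * norm (stair w0) \<le> 2 / (r * \<epsilon>)"
    using nz \<epsilon> \<open>r > 0\<close> by (simp add: field_simps)
  have "norm (deriv (\<lambda>w. \<sigma> * wave \<epsilon> z0 w) w0) * r \<le> 2 * Re (\<sigma> * wave \<epsilon> z0 w0)"
    using \<open>r > 0\<close> M by (intro norm_deriv_le_Re holomorphic_intros holomorphic_wave)
       (auto intro!: pos simp: dist_norm norm_minus_commute)
  also have "deriv (\<lambda>w. \<sigma> * wave \<epsilon> z0 w) w0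
      = \<sigma> * (wave \<epsilon> z0 w0 * (\<epsilon> * (stair' w0 * (stair z0 - stair w0 ^ 3))))"
    by (intro DERIV_imp_deriv DERIV_cmult has_field_derivative_wave)
  finally have "norm (wave \<epsilon> z0 w0) * (\<epsilon> * (norm (stair' w0) * norm (stair z0 - stair w0 ^ 3)) * r)
      \<le> norm (wave \<epsilon> z0 w0) * 2"
    using \<sigma> \<epsilon> Re_le by (auto simp: norm_mult mult_ac)
  then show "norm (stair' w0) * norm (stair z0 - stair w0 ^ 3) \<le> 2 / (r * \<epsilon>)"
    using nz \<epsilon> \<open>r > 0\<close> by (simp add: field_simps)
  show "exp M \<le> norm (wave \<epsilon> z0 w0) + 2"
    using Re_pos[of z0 w0] Re_le \<open>r > 0\<close> by simp
qed

lemma move_off_real_axis: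
  obtains z' :: complex where "norm (z' - z) = 1 / 4" "\<bar>Im z'\<bar> \<ge> 1 / 4"
proof (cases "Im z \<ge> 0")
  case True
  then show ?thesis by (intro that[of "z + \<i> / 4"]) (auto simp: norm_divide)
next
  case False
  then show ?thesis by (intro that[of "z - \<i> / 4"]) (auto simp: norm_divide)
qed

text \<open>
  If \<open>Re wave\<close> is within \<open>\<delta>\<close> of \<open>-2\<close> on a polydisc, then \<open>\<partial>wave/\<partial>z = \<epsilon> S'(z) S(w) wave\<close> is \<open>O(\<delta>)\<close>; since
  \<open>S'(z)\<close> is not small off the real axis, \<open>S(w)\<close> and by Cauchy's inequality \<open>S'(w)\<close> are small.
\<close>

lemma osc_small:
  assumes \<epsilon>: "\<epsilon> > 0" and \<delta>: "0 < \<delta>" "\<delta> \<le> 1"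
    and small: "\<And>z w. norm (z - z0) \<le> 1 / 2 \<Longrightarrow> norm (w - w0) \<le> 1 / 2 \<Longrightarrow> \<bar>osc \<epsilon> z w\<bar> < \<delta>"
  shows "\<epsilon> \<le> 1024 * \<delta> * (1 + norm z0 + norm w0)\<^sup>2"
proof -
  define R where "R = 1 + norm z0 + norm w0"
  \<comment> \<open>A shift by 1/4 leaves room for a disc of radius 1/4 inside the given disc of
    radius 1/2.\<close>
  obtain z1 where z1: "norm (z1 - z0) = 1 / 4" "\<bar>Im z1\<bar> \<ge> 1 / 4" by (rule move_off_real_axis)
  obtain w1 where w1: "norm (w1 - w0) = 1 / 4" "\<bar>Im w1\<bar> \<ge> 1 / 4" by (rule move_off_real_axis)
  have R: "norm z1 \<le> R" "norm w1 \<le> R"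
    using z1 w1 norm_triangle_sub[of z1 z0] norm_triangle_sub[of w1 w0] norm_ge_zero[of z0] norm_ge_zero[of w0]
    unfolding R_def by linarith+
  have "R \<ge> 1" by (simp add: R_def)
  have Sw: "norm (stair w) \<le> 64 * \<delta> * R / \<epsilon>" if w: "norm (w - w0) \<le> 1 / 2" for w
  proof -
    have near: "norm (z - z0) \<le> 1 / 2" if "z \<in> cball z1 (1 / 4)" for z
      using that z1(1) norm_triangle_ineq[of "z - z1" "z1 - z0"] by (simp add: dist_norm norm_minus_commute)
    \<comment> \<open>The real part of wave + 2 + \<delta> lies between 0 and 2 \<delta>, so the
      gradient estimate makes the derivative O(\<delta>).\<close>
    have pos: "Re (wave \<epsilon> z w + (2 + \<delta>)) > 0" if "z \<in> cball z1 (1 / 4)" for z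
      using small[OF near[OF that] w] by (auto simp: osc_def)
    have "norm (deriv (\<lambda>z. wave \<epsilon> z w + (2 + \<delta>)) z1) * (1 / 4) \<le> 2 * Re (wave \<epsilon> z1 w + (2 + \<delta>))"
      using pos by (intro norm_deriv_le_Re holomorphic_intros holomorphic_wave) auto
    also have "deriv (\<lambda>z. wave \<epsilon> z w + (2 + \<delta>)) z1 = wave \<epsilon> z1 w * (\<epsilon> * (stair' z1 * stair w)) + 0"
      by (intro DERIV_imp_deriv DERIV_add has_field_derivative_wave DERIV_const)
    also have "2 * Re (wave \<epsilon> z1 w + (2 + \<delta>)) \<le> 4 * \<delta>"
      using small[OF near w, of z1] by (auto simp: osc_def)
    finally have le: "norm (wave \<epsilon> z1 w) * (\<epsilon> * (norm (stair' z1) * norm (stair w))) \<le> 16 * \<delta>"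
      using \<epsilon> by (simp add: norm_mult)
    have "1 \<le> \<bar>Re (wave \<epsilon> z1 w)\<bar>"
      using small[OF near w, of z1] \<delta> by (auto simp: osc_def)
    then have "1 \<le> norm (wave \<epsilon> z1 w)"
      using abs_Re_le_cmod order_trans by blast
    then have "1 * (\<epsilon> * (norm (stair' z1) * norm (stair w)))
        \<le> norm (wave \<epsilon> z1 w) * (\<epsilon> * (norm (stair' z1) * norm (stair w)))"
      using \<epsilon> by (intro mult_right_mono) auto
    with le have le: "\<epsilon> * (norm (stair' z1) * norm (stair w)) \<le> 16 * \<delta>" by simp
    have "1 / 4 \<le> norm (stair' z1) * norm z1" by (rule norm_stair'_ge[OF z1(2)])
    also have "\<dots> \<le> norm (stair' z1) * R" using R by (intro mult_left_mono) auto
    finally have "\<epsilon> * norm (stair w) * (1 / 4) \<le> \<epsilon> * norm (stair w) * (norm (stair' z1) * R)"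
      using \<epsilon> by (intro mult_left_mono) auto
    also have "\<dots> = \<epsilon> * (norm (stair' z1) * norm (stair w)) * R" by (simp add: mult_ac)
    also have "\<dots> \<le> 16 * \<delta> * R" using le \<open>R \<ge> 1\<close> by (intro mult_right_mono) auto
    finally show ?thesis using \<epsilon> by (simp add: field_simps)
  qed
  have "norm ((deriv ^^ 1) stair w1) \<le> fact 1 * (64 * \<delta> * R / \<epsilon>) / (1 / 4) ^ 1"
  proof (rule Cauchy_inequality)
    fix x assume x: "norm (w1 - x) = 1 / 4"
    have "norm (x - w0) \<le> 1 / 2"
      using x w1(1) norm_triangle_ineq[of "x - w1" "w1 - w0"] by (simp add: norm_minus_commute)
    then show "norm (stair x) \<le> 64 * \<delta> * R / \<epsilon>" by (rule Sw)
  qed (auto intro: holomorphic_stair continuous_stair)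
  then have D: "norm (stair' w1) \<le> 256 * \<delta> * R / \<epsilon>" by (simp add: deriv_stair)
  \<comment> \<open>The upper bound for S'(w1) meets the lower bound off the real axis; this forces
    \<delta> to be at least of order \<epsilon> / R^2.\<close>
  have "1 / 4 \<le> norm (stair' w1) * norm w1" by (rule norm_stair'_ge[OF w1(2)])
  also have "\<dots> \<le> 256 * \<delta> * R / \<epsilon> * R" using D R \<open>R \<ge> 1\<close> \<epsilon> \<delta> by (intro mult_mono) auto
  finally have "\<epsilon> \<le> 1024 * \<delta> * R\<^sup>2" using \<epsilon> by (simp add: field_simps power2_eq_square)
  then show ?thesis by (simp only: R_def)
qed

text \<open>If it failed, the connected range of \<open>osc\<close> on the polydisc would avoid all
  moderate values, hence be entirely tiny, or entirely large with one sign. The first contradicts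
  \<open>osc_small\<close>, the second \<open>osc_large\<close> together with
  \<open>Re_phase_le\<close>.\<close>

lemma osc_moderate:
  assumes \<epsilon>: "\<epsilon> > 0"
  obtains K where "K > 0"
    "\<And>z0 w0. \<exists>z w. norm (z - z0) \<le> 1 / 2 \<and> norm (w - w0) \<le> 1 / 2 \<and>
        exp (- (K * (1 + norm z0 + norm w0) powr (4 / 3))) \<le> \<bar>osc \<epsilon> z w\<bar> \<and>
        \<bar>osc \<epsilon> z w\<bar> \<le> exp (K * (1 + norm z0 + norm w0) powr (4 / 3))"
proof -
  obtain C where C: "C > 0"
    "\<And>z w. norm (stair' z) * norm (stair w) \<le> 4 / \<epsilon> \<Longrightarrow> norm (stair' w) * norm (stair z - stair w ^ 3) \<le> 4 / \<epsilon>
      \<Longrightarrow> Re (phase z w) \<le> C * (1 + norm z) powr (4 / 3)"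
    using Re_phase_le[of "4 / \<epsilon>"] \<epsilon> by auto
  \<comment> \<open>\<epsilon> C serves the large case, 1024 / \<epsilon> the small case, and 3
    gives slack in both.\<close>
  define K where "K = \<epsilon> * C + 3 + 1024 / \<epsilon>"
  have K: "K > 0" using C(1) \<epsilon> by (simp add: K_def add_pos_pos)
  have "\<exists>z w. norm (z - z0) \<le> 1 / 2 \<and> norm (w - w0) \<le> 1 / 2 \<and>
        exp (- (K * (1 + norm z0 + norm w0) powr (4 / 3))) \<le> \<bar>osc \<epsilon> z w\<bar> \<and>
        \<bar>osc \<epsilon> z w\<bar> \<le> exp (K * (1 + norm z0 + norm w0) powr (4 / 3))" for z0 w0
  proof (rule ccontr)
    assume contra: "\<not> ?thesis"
    define R where "R = 1 + norm z0 + norm w0"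
    define P where "P = R powr (4 / 3)"
    have R: "R \<ge> 1" by (simp add: R_def)
    then have P: "P \<ge> R" using powr_mono[of 1 "4 / 3" R] by (simp add: P_def)
    define M where "M = K * P"
    define Q where "Q = cball z0 (1 / 2) \<times> cball w0 (1 / 2)"
    have Q: "(z, w) \<in> Q \<longleftrightarrow> norm (z - z0) \<le> 1 / 2 \<and> norm (w - w0) \<le> 1 / 2" for z w
      by (simp add: Q_def dist_norm norm_minus_commute)
    define I where "I = (\<lambda>(z, w). osc \<epsilon> z w) ` Q"
    have "connected Q"
      unfolding Q_def by (intro convex_connected convex_Times convex_cball)
    then have conn: "connected I"
      unfolding I_def by (intro connected_continuous_image continuous_on_osc)
    have out: "\<bar>y\<bar> < exp (- M) \<or> exp M < \<bar>y\<bar>" if y: "y \<in> I" for y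
    proof -
      obtain z w where "y = osc \<epsilon> z w" "norm (z - z0) \<le> 1 / 2" "norm (w - w0) \<le> 1 / 2"
        using y unfolding I_def by (auto simp: Q)
      then show ?thesis
        using contra unfolding M_def P_def R_def by (metis not_le)
    qed
    have "K * 1 \<le> K * P" using P R K by (intro mult_left_mono) auto
    moreover have "3 \<le> K" using C(1) \<epsilon> by (simp add: K_def)
    ultimately have M3: "M \<ge> 3" unfolding M_def by linarith
    then have expM: "exp M \<ge> 4" using exp_ge_add_one_self[of M] by linarith
    then have expM': "exp (- M) \<le> 1 / 4" by (simp add: exp_minus field_simps)
    define c where "c = osc \<epsilon> z0 w0"
    have c: "c \<in> I" unfolding I_def c_def by (auto simp: Q intro!: image_eqI[of _ _ "(z0, w0)"])
    have I: "osc \<epsilon> z w \<in> I" if "norm (z - z0) \<le> 1 / 2" "norm (w - w0) \<le> 1 / 2" for z w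
      unfolding I_def using that by (auto simp: Q intro!: image_eqI[of _ _ "(z, w)"])
    \<comment> \<open>The range cannot cross 1/2 or -1/2, since exp (-M) < 1/2 < exp M.\<close>
    have gap1: False if "y \<in> I" "y' \<in> I" "y \<le> 1 / 2" "1 / 2 \<le> y'" for y y'
      using out[OF connectedD_interval[OF conn that]] expM expM' by auto
    have gap2: False if "y \<in> I" "y' \<in> I" "y \<le> - (1 / 2)" "- (1 / 2) \<le> y'" for y y'
      using out[OF connectedD_interval[OF conn that]] expM expM' by auto
    show False
    proof (cases "\<bar>c\<bar> < exp (- M)")
      case True
      have small: "\<bar>y\<bar> < exp (- M)" if "y \<in> I" for y
      proof (rule ccontr)
        assume "\<not> ?thesis"
        then have "1 / 2 \<le> y \<or> y \<le> - (1 / 2)" using out[OF that] expM by linarith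
        moreover have "c \<le> 1 / 2" "- (1 / 2) \<le> c" using True expM' by linarith+
        ultimately show False using gap1[OF c that] gap2[OF that c] by blast
      qed
      have "\<epsilon> \<le> 1024 * exp (- M) * R\<^sup>2"
        unfolding R_def using \<epsilon> expM' M3 by (intro osc_small) (auto intro!: small I)
      then have "\<epsilon> * exp M \<le> 1024 * R\<^sup>2"
        by (simp add: exp_minus field_simps)
      \<comment> \<open>M is at least 1024 / \<epsilon> + 2 R, and x < exp x is applied to each
        factor.\<close>
      moreover have "1024 * R\<^sup>2 < \<epsilon> * exp M"
      proof -
        have "1024 / \<epsilon> + 2 * R \<le> (1024 / \<epsilon>) * P + 2 * P"
          using P R \<epsilon> by (intro add_mono) (auto simp: field_simps)
        also have "\<dots> \<le> M"
          using C(1) \<epsilon> P R by (simp add: M_def K_def algebra_simps)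
        finally have "exp (1024 / \<epsilon>) * exp R ^ 2 \<le> exp M"
          by (simp flip: exp_add exp_double)
        moreover have less_exp: "x < exp x" for x :: real
          using exp_ge_add_one_self[of x] by linarith
        moreover have "(1024 / \<epsilon>) * R ^ 2 < exp (1024 / \<epsilon>) * exp R ^ 2"
          using R \<epsilon> less_exp by (intro mult_strict_mono power_strict_mono) auto
        ultimately have "(1024 / \<epsilon>) * R ^ 2 < exp M" by simp
        then show ?thesis using \<epsilon> by (simp add: field_simps)
      qed
      ultimately show False by simp
    next
      case False
      then have c_large: "exp M < \<bar>c\<bar>" using out[OF c] by simp
      define \<sigma> where "\<sigma> = sgn c"
      have \<sigma>: "\<sigma> = 1 \<or> \<sigma> = - 1"
        using c_large expM by (auto simp: \<sigma>_def sgn_if)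
      have large: "\<sigma> * y > exp M" if y: "y \<in> I" for y
      proof (cases "c > 0")
        case True
        then have "c \<ge> 1 / 2" using c_large expM by linarith
        then have "\<not> y \<le> 1 / 2" using gap1[OF y c] by blast
        then have "y > exp M" using out[OF y] expM' by linarith
        then show ?thesis using True by (simp add: \<sigma>_def)
      next
        case False
        then have c': "c \<le> - (1 / 2)" "c < 0" using c_large expM by linarith+
        then have "\<not> - (1 / 2) \<le> y" using gap2[OF c y] by blast
        then have "- y > exp M" using out[OF y] expM' by linarith
        then show ?thesis using c' by (simp add: \<sigma>_def)
      qed
      have r: "(0::real) < 1 / 2" and M': "exp M \<ge> 3" using expM by simp_all
      note * = osc_large[OF \<epsilon> r M' large[OF I] \<sigma>, of z0 w0, simplified]
      have "norm (stair' z0) * norm (stair w0) \<le> 4 / \<epsilon>"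
        "norm (stair' w0) * norm (stair z0 - stair w0 ^ 3) \<le> 4 / \<epsilon>"
        and W: "exp M \<le> norm (wave \<epsilon> z0 w0) + 2"
        using * by simp_all
      then have "Re (phase z0 w0) \<le> C * (1 + norm z0) powr (4 / 3)" by (intro C(2))
      also have "\<dots> \<le> C * P"
        unfolding P_def using C(1) by (intro mult_left_mono powr_mono2) (auto simp: R_def)
      finally have "\<epsilon> * Re (phase z0 w0) \<le> \<epsilon> * (C * P)" using \<epsilon> by (intro mult_left_mono) auto
      moreover have "\<epsilon> * (C * P) + 3 \<le> M"
      proof -
        have "3 * 1 \<le> 3 * P" "0 \<le> 1024 / \<epsilon> * P" using P R \<epsilon> by auto
        then show ?thesis by (simp add: M_def K_def algebra_simps)
      qed
      \<comment> \<open>The slack gives 4 |wave| \<le> exp M, against exp M \<le> |wave| + 2 and exp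
        M \<ge> 4.\<close>
      ultimately have "exp (\<epsilon> * Re (phase z0 w0) + 3) \<le> exp M" by simp
      then have "norm (wave \<epsilon> z0 w0) * exp 3 \<le> exp M" by (simp add: norm_wave exp_add)
      moreover have "norm (wave \<epsilon> z0 w0) * 4 \<le> norm (wave \<epsilon> z0 w0) * exp 3"
        using exp_ge_add_one_self[of 3] by (intro mult_left_mono) auto
      ultimately show False using W expM by linarith
    qed
  qed
  with K show ?thesis by (rule that)
qed

section \<open>Smoothness and harmonicity\<close>

text \<open>
  Closed under partial differentiation: every member has a derivative \<open>v \<mapsto> f\<^sub>1 p(v) + f\<^sub>2 q(v)\<close> with
  \<open>f\<^sub>1\<close> and \<open>f\<^sub>2\<close> again in the algebra.
\<close>

inductive_set holo_alg :: "('a \<Rightarrow> complex) \<Rightarrow> ('a \<Rightarrow> complex) \<Rightarrow> ('a \<Rightarrow> complex) set"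
  for p q :: "'a \<Rightarrow> complex" where
  left: "p \<in> holo_alg p q"
| right: "q \<in> holo_alg p q"
| const: "(\<lambda>x. c) \<in> holo_alg p q"
| add: "f \<in> holo_alg p q \<Longrightarrow> g \<in> holo_alg p q \<Longrightarrow> (\<lambda>x. f x + g x) \<in> holo_alg p q"
| mult: "f \<in> holo_alg p q \<Longrightarrow> g \<in> holo_alg p q \<Longrightarrow> (\<lambda>x. f x * g x) \<in> holo_alg p q"
| comp: "h holomorphic_on UNIV \<Longrightarrow> f \<in> holo_alg p q \<Longrightarrow> (\<lambda>x. h (f x)) \<in> holo_alg p q"

lemma holo_alg_has_derivative:
  assumes p: "bounded_linear p" and q: "bounded_linear q" and f: "f \<in> holo_alg p q"
  shows "\<exists>f1\<in>holo_alg p q. \<exists>f2\<in>holo_alg p q. \<forall>x. (f has_derivative (\<lambda>v. f1 x * p v + f2 x * q v)) (at x)"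
  using f
proof induction
  case left
  show ?case
    by (rule bexI[OF bexI[OF allI holo_alg.const[of 0]] holo_alg.const[of 1]])
       (simp add: bounded_linear_imp_has_derivative p)
next
  case right
  show ?case
    by (rule bexI[OF bexI[OF allI holo_alg.const[of 1]] holo_alg.const[of 0]])
       (simp add: bounded_linear_imp_has_derivative q)
next
  case (const c)
  show ?case
    by (rule bexI[OF bexI[OF allI holo_alg.const[of 0]] holo_alg.const[of 0]]) simp
next
  case (add f g)
  then obtain f1 f2 g1 g2 where *: "f1 \<in> holo_alg p q" "f2 \<in> holo_alg p q" "g1 \<in> holo_alg p q" "g2 \<in> holo_alg p q"
    and d: "\<And>x. (f has_derivative (\<lambda>v. f1 x * p v + f2 x * q v)) (at x)"
      "\<And>x. (g has_derivative (\<lambda>v. g1 x * p v + g2 x * q v)) (at x)"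
    by blast
  have "((\<lambda>x. f x + g x) has_derivative (\<lambda>v. (f1 x + g1 x) * p v + (f2 x + g2 x) * q v)) (at x)" for x
    by (rule has_derivative_eq_rhs[OF has_derivative_add[OF d]]) (simp add: algebra_simps)
  with * show ?case
    by (intro bexI[of _ "\<lambda>x. f1 x + g1 x"] bexI[of _ "\<lambda>x. f2 x + g2 x"] holo_alg.add) auto
next
  case (mult f g)
  then obtain f1 f2 g1 g2 where *: "f1 \<in> holo_alg p q" "f2 \<in> holo_alg p q" "g1 \<in> holo_alg p q" "g2 \<in> holo_alg p q"
    and d: "\<And>x. (f has_derivative (\<lambda>v. f1 x * p v + f2 x * q v)) (at x)"
      "\<And>x. (g has_derivative (\<lambda>v. g1 x * p v + g2 x * q v)) (at x)"
    by blast
  have "((\<lambda>x. f x * g x) has_derivative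
      (\<lambda>v. (f x * g1 x + f1 x * g x) * p v + (f x * g2 x + f2 x * g x) * q v)) (at x)" for x
    by (rule has_derivative_eq_rhs[OF has_derivative_mult[OF d]]) (simp add: algebra_simps)
  with * mult.hyps show ?case
    by (intro bexI[of _ "\<lambda>x. f x * g1 x + f1 x * g x"] bexI[of _ "\<lambda>x. f x * g2 x + f2 x * g x"]
        holo_alg.add holo_alg.mult) auto
next
  case (comp h f)
  then obtain f1 f2 where *: "f1 \<in> holo_alg p q" "f2 \<in> holo_alg p q"
    and d: "\<And>x. (f has_derivative (\<lambda>v. f1 x * p v + f2 x * q v)) (at x)"
    by blast
  have h: "(h has_derivative (*) (deriv h z)) (at z)" for z
    using holomorphic_derivI[OF comp.hyps(1) open_UNIV UNIV_I] by (simp add: has_field_derivative_def)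
  have "((\<lambda>x. h (f x)) has_derivative
      (\<lambda>v. (deriv h (f x) * f1 x) * p v + (deriv h (f x) * f2 x) * q v)) (at x)" for x
    by (rule has_derivative_eq_rhs[OF has_derivative_compose[OF d h]]) (simp add: algebra_simps)
  moreover have "(\<lambda>x. deriv h (f x)) \<in> holo_alg p q"
    by (rule holo_alg.comp[OF holomorphic_deriv[OF comp.hyps(1) open_UNIV] comp.hyps(2)])
  ultimately show ?case using *
    by (intro bexI[of _ "\<lambda>x. deriv h (f x) * f1 x"] bexI[of _ "\<lambda>x. deriv h (f x) * f2 x"] holo_alg.mult) auto
qed

lemma Re_holo_alg_frechet:
  assumes "bounded_linear p" "bounded_linear q" "f \<in> holo_alg p q"
  obtains f1 f2 where "f1 \<in> holo_alg p q" "f2 \<in> holo_alg p q"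
    "\<And>x. (\<lambda>x. Re (f x)) differentiable (at x)"
    "\<And>x v. frechet_derivative (\<lambda>x. Re (f x)) (at x) v = Re (f1 x * p v + f2 x * q v)"
proof -
  obtain f1 f2 where *: "f1 \<in> holo_alg p q" "f2 \<in> holo_alg p q"
    and d: "\<And>x. (f has_derivative (\<lambda>v. f1 x * p v + f2 x * q v)) (at x)"
    using holo_alg_has_derivative[OF assms] by blast
  have D: "((\<lambda>x. Re (f x)) has_derivative (\<lambda>v. Re (f1 x * p v + f2 x * q v))) (at x)" for x
    using d by (rule has_derivative_Re)
  show ?thesis
  proof (rule that[OF *])
    show "(\<lambda>x. Re (f x)) differentiable (at x)" for x
      using D unfolding differentiable_def by blast
    show "frechet_derivative (\<lambda>x. Re (f x)) (at x) v = Re (f1 x * p v + f2 x * q v)" for x v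
      by (simp only: frechet_derivative_at[OF D, symmetric])
  qed
qed

text \<open>Induction on the order: each directional derivative is again the real part of a member
  of the algebra.\<close>

lemma smooth_Re_holo_alg:
  assumes p: "bounded_linear p" and q: "bounded_linear q" and f: "f \<in> holo_alg p q"
  shows "smooth (\<lambda>x. Re (f x))"
proof -
  have "C_diff k (\<lambda>x. Re (f x))" for k
    using f
  proof (induction k arbitrary: f)
    case 0
    have "(\<lambda>x. Re (f x)) differentiable (at x)" for x
      by (rule Re_holo_alg_frechet[OF p q 0]) blast
    then show ?case
      by (simp add: continuous_on_eq_continuous_at differentiable_imp_continuous_within)
  next
    case (Suc k)
    obtain f1 f2 where *: "f1 \<in> holo_alg p q" "f2 \<in> holo_alg p q"
      "\<And>x. (\<lambda>x. Re (f x)) differentiable (at x)"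
      "\<And>x v. frechet_derivative (\<lambda>x. Re (f x)) (at x) v = Re (f1 x * p v + f2 x * q v)"
      by (rule Re_holo_alg_frechet[OF p q Suc.prems]) (rule that)
    have "(\<lambda>x. f1 x * p v + f2 x * q v) \<in> holo_alg p q" for v
      using * by (intro holo_alg.add holo_alg.mult holo_alg.const)
    then show ?case
      unfolding C_diff.simps *(4) differentiable_on_def
      using differentiable_at_withinI[OF *(3)] Suc.IH by blast
  qed
  then show ?thesis by (simp add: smooth_def)
qed

text \<open>The second derivative in direction e is the real part of a quadratic form in p(e), q(e).
  Summing over the basis leaves only the three sums assumed to vanish.\<close>

lemma laplacian_Re_holo_alg:
  assumes p: "bounded_linear p" and q: "bounded_linear q" and f: "f \<in> holo_alg p q"
    and isotropic: "(\<Sum>e\<in>Basis. p e * p e) = 0" "(\<Sum>e\<in>Basis. p e * q e) = 0" "(\<Sum>e\<in>Basis. q e * q e) = 0"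
  shows "laplacian (\<lambda>x. Re (f x)) x = 0"
proof -
  obtain f1 f2 where f12: "f1 \<in> holo_alg p q" "f2 \<in> holo_alg p q"
    "\<And>x v. frechet_derivative (\<lambda>x. Re (f x)) (at x) v = Re (f1 x * p v + f2 x * q v)"
    by (rule Re_holo_alg_frechet[OF p q f]) (rule that)
  obtain f11 f12' where f1: "\<And>x. (f1 has_derivative (\<lambda>v. f11 x * p v + f12' x * q v)) (at x)"
    using holo_alg_has_derivative[OF p q f12(1)] by blast
  obtain f21 f22 where f2: "\<And>x. (f2 has_derivative (\<lambda>v. f21 x * p v + f22 x * q v)) (at x)"
    using holo_alg_has_derivative[OF p q f12(2)] by blast
  have "((\<lambda>x. Re (f1 x * p e + f2 x * q e)) has_derivative
      (\<lambda>v. Re ((f11 x * p v + f12' x * q v) * p e + (f21 x * p v + f22 x * q v) * q e))) (at x)" for e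
    by (intro has_derivative_Re has_derivative_add has_derivative_mult_left f1 f2)
  note D = frechet_derivative_at[OF this, symmetric]
  have "partial e (partial e (\<lambda>x. Re (f x))) x
      = Re (f11 x * (p e * p e) + (f12' x + f21 x) * (p e * q e) + f22 x * (q e * q e))" for e
    unfolding partial_def f12(3) D by (simp only: algebra_simps)
  then have "laplacian (\<lambda>x. Re (f x)) x
      = Re (f11 x * (\<Sum>e\<in>Basis. p e * p e) + (f12' x + f21 x) * (\<Sum>e\<in>Basis. p e * q e)
          + f22 x * (\<Sum>e\<in>Basis. q e * q e))"
    unfolding laplacian_def by (simp only: Re_sum[symmetric] sum.distrib sum_distrib_left)
  then show ?thesis by (simp add: isotropic)
qed

section \<open>Complex coordinates on real space\<close>

definition coord_pair :: "'n \<Rightarrow> 'n \<Rightarrow> real ^ 'n \<Rightarrow> complex" where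
  "coord_pair i j x = Complex (x $ i) (x $ j)"

definition embed_pair :: "'n \<Rightarrow> 'n \<Rightarrow> complex \<Rightarrow> real ^ 'n" where
  "embed_pair i j a = axis i (Re a) + axis j (Im a)"

lemma bounded_linear_coord_pair: "bounded_linear (coord_pair i j :: real ^ 'n::finite \<Rightarrow> complex)"
proof -
  have "bounded_linear (\<lambda>x :: real ^ 'n. of_real (x $ i) + \<i> * of_real (x $ j))"
    by (intro bounded_linear_add bounded_linear_const_mult
        bounded_linear_compose[OF bounded_linear_of_real] bounded_linear_vec_nth)
  then show ?thesis by (simp add: coord_pair_def[abs_def] Complex_eq)
qed

lemma coord_pair_add: "coord_pair i j (x + y) = coord_pair i j x + coord_pair i j y"
  and coord_pair_diff: "coord_pair i j (x - y) = coord_pair i j x - coord_pair i j y"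
  by (simp_all add: coord_pair_def complex_eq_iff)

lemma coord_pair_embed_pair:
  "i \<noteq> j \<Longrightarrow> coord_pair i j (embed_pair i j a) = a"
  "i \<noteq> i' \<Longrightarrow> i \<noteq> j' \<Longrightarrow> j \<noteq> i' \<Longrightarrow> j \<noteq> j' \<Longrightarrow> coord_pair i j (embed_pair i' j' a) = 0"
  by (auto simp: coord_pair_def embed_pair_def axis_def complex_eq_iff)

lemma norm_embed_pair:
  fixes i j :: "'n::finite"
  assumes "i \<noteq> j"
  shows "norm (embed_pair i j a) = norm a"
proof -
  have "embed_pair i j a \<bullet> embed_pair i j a = (Re a)\<^sup>2 + (Im a)\<^sup>2"
    using assms by (simp add: embed_pair_def inner_add_left inner_add_right inner_axis_axis power2_eq_square)
  then show ?thesis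
    by (simp only: norm_eq_sqrt_inner[of "embed_pair i j a"] cmod_def)
qed

lemma norm_coord_pair_le:
  fixes x :: "real ^ 'n::finite"
  assumes "i \<noteq> j"
  shows "norm (coord_pair i j x) \<le> norm x"
proof -
  have "(norm (coord_pair i j x))\<^sup>2 = (\<Sum>k\<in>{i, j}. x $ k * x $ k)"
    using assms unfolding cmod_power2 by (simp add: coord_pair_def power2_eq_square)
  also have "\<dots> \<le> (\<Sum>k\<in>UNIV. x $ k * x $ k)"
    by (intro sum_mono2) auto
  also have "\<dots> = (norm x)\<^sup>2"
    by (simp add: power2_norm_eq_inner inner_vec_def)
  finally show ?thesis by (rule power2_le_imp_le) simp
qed

lemma sum_Basis_vec:
  fixes g :: "real ^ 'n::finite \<Rightarrow> 'b::comm_monoid_add"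
  shows "(\<Sum>e\<in>Basis. g e) = (\<Sum>k\<in>UNIV. g (axis k 1))"
proof -
  have inj: "inj (\<lambda>k :: 'n. axis k (1::real))" by (auto intro!: injI simp: axis_eq_axis)
  have "(\<Sum>e\<in>Basis. g e) = sum g (range (\<lambda>k :: 'n. axis k (1::real)))"
    by (rule sum.cong) (auto simp: Basis_vec_def)
  then show ?thesis unfolding sum.reindex[OF inj] o_def .
qed

text \<open>The only nonzero values on the basis are 1 and the imaginary unit, whose squares
  cancel.\<close>

lemma coord_pair_isotropic:
  fixes i j :: "'n::finite"
  assumes "i \<noteq> j"
  shows "(\<Sum>e\<in>Basis. coord_pair i j e * coord_pair i j e) = 0"
proof -
  have "coord_pair i j (axis k 1) * coord_pair i j (axis k 1)
      = (if k = i then 1 else 0) + (if k = j then - 1 else 0)" for k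
    using assms by (auto simp: coord_pair_def axis_def complex_eq_iff)
  then show ?thesis by (simp add: sum_Basis_vec sum.distrib)
qed

lemma coord_pair_orthogonal:
  fixes i j i' j' :: "'n::finite"
  assumes "i \<noteq> i'" "i \<noteq> j'" "j \<noteq> i'" "j \<noteq> j'"
  shows "(\<Sum>e\<in>Basis. coord_pair i j e * coord_pair i' j' e) = 0"
proof -
  have *: "coord_pair i j (axis k 1) * coord_pair i' j' (axis k 1) = 0" for k
    using assms by (auto simp: coord_pair_def axis_def complex_eq_iff)
  show ?thesis unfolding sum_Basis_vec by (simp only: * sum.neutral_const)
qed

section \<open>From size estimates to the upper limit\<close>

lemma lnln_abs_le:
  assumes "M > 0" "exp (- M) \<le> \<bar>t\<bar>" "\<bar>t\<bar> \<le> exp M"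
  shows "lnln_abs t \<le> ereal (ln M)"
proof (cases "\<bar>t\<bar> = 1")
  case True
  then show ?thesis by (simp add: lnln_abs_unit)
next
  case False
  have t: "\<bar>t\<bar> > 0" using assms(2) exp_gt_zero[of "- M"] by linarith
  have "ln \<bar>t\<bar> \<le> M" "- M \<le> ln \<bar>t\<bar>"
    using assms t by (metis exp_gt_zero ln_exp ln_mono)+
  moreover have "\<bar>ln \<bar>t\<bar>\<bar> > 0" using False t by simp
  ultimately have "ln \<bar>ln \<bar>t\<bar>\<bar> \<le> ln M" by simp
  then show ?thesis using False t by (simp add: lnln_abs_real)
qed

text \<open>One point of moderate size in each ball bounds the infimum over that ball.\<close>

lemma Limsup_loglog_ratio_le:
  fixes u :: "'a::euclidean_space \<Rightarrow> real"
  assumes K: "K > 0"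
    and moderate: "\<And>x0. \<exists>x\<in>cball x0 1. exp (- (K * (1 + norm x0) powr (4 / 3))) \<le> \<bar>u x\<bar> \<and>
      \<bar>u x\<bar> \<le> exp (K * (1 + norm x0) powr (4 / 3))"
  shows "Limsup at_infinity (\<lambda>x0. INF x\<in>cball x0 1. loglog_ratio u x) \<le> ereal (4 / 3)"
proof -
  \<comment> \<open>The modulus of \<open>ln K\<close> keeps the numerator nonnegative, so ln |x|
    may be replaced by the smaller ln (r - 1), the least value on the ball.\<close>
  define g where "g r = (\<bar>ln K\<bar> + 4 / 3 * ln (1 + r)) / ln (r - 1)" for r :: real
  have "(INF x\<in>cball x0 1. loglog_ratio u x) \<le> ereal (g (norm x0))" if x0: "norm x0 \<ge> 3" for x0
  proof -
    define M where "M = K * (1 + norm x0) powr (4 / 3)"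
    obtain x where x: "x \<in> cball x0 1" "exp (- M) \<le> \<bar>u x\<bar>" "\<bar>u x\<bar> \<le> exp M"
      using moderate[of x0] unfolding M_def by blast
    have "M > 0" using K x0 by (auto simp: M_def)
    have nx: "norm x0 - 1 \<le> norm x"
      using x(1) norm_triangle_ineq2[of x0 x] by (simp add: dist_norm)
    have ln0: "0 < ln (norm x0 - 1)" using x0 by simp
    have lnx: "ln (norm x0 - 1) \<le> ln (norm x)" using nx x0 by (subst ln_le_cancel_iff) linarith+
    have "ln M = ln K + 4 / 3 * ln (1 + norm x0)"
      using K x0 by (simp add: M_def ln_mult ln_powr)
    then have lnM: "ln M \<le> \<bar>ln K\<bar> + 4 / 3 * ln (1 + norm x0)" by simp
    have num: "0 \<le> \<bar>ln K\<bar> + 4 / 3 * ln (1 + norm x0)"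
      by (intro add_nonneg_nonneg mult_nonneg_nonneg ln_ge_zero) auto
    have "loglog_ratio u x \<le> ereal (ln M) / ereal (ln (norm x))"
      unfolding loglog_ratio_def
      using lnln_abs_le[OF \<open>M > 0\<close> x(2,3)] ln0 lnx by (intro ereal_divide_right_mono) auto
    also have "\<dots> = ereal (ln M / ln (norm x))" using ln0 lnx by simp
    also have "\<dots> \<le> ereal (g (norm x0))"
      unfolding g_def ereal_less_eq(3) by (rule frac_le[OF num lnM ln0 lnx])
    finally show ?thesis using INF_lower[OF x(1), of "loglog_ratio u"] by (rule order_trans[rotated])
  qed
  then have "eventually (\<lambda>x0. (INF x\<in>cball x0 1. loglog_ratio u x) \<le> ereal (g (norm x0))) at_infinity"
    unfolding eventually_at_infinity by blast
  then have "Limsup at_infinity (\<lambda>x0. INF x\<in>cball x0 1. loglog_ratio u x)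
      \<le> Limsup at_infinity (\<lambda>x0::'a. ereal (g (norm x0)))"
    by (rule Limsup_mono)
  also have "\<dots> = ereal (4 / 3)"
  proof (rule lim_imp_Limsup)
    have "(g \<longlongrightarrow> 4 / 3) at_top"
      unfolding g_def by real_asymp
    then show "((\<lambda>x0::'a. ereal (g (norm x0))) \<longlongrightarrow> ereal (4 / 3)) at_infinity"
      by (intro tendsto_ereal filterlim_compose[OF _ filterlim_norm_at_top])
  qed (rule trivial_limit_at_infinity)
  finally show ?thesis .
qed

text \<open>Balls along a sequence going to infinity suffice: a value y strictly between the upper
  limit and l would be exceeded by the infimum on almost all of them.\<close>

lemma le_Limsup_loglog_ratio:
  fixes u :: "'a::euclidean_space \<Rightarrow> real"
  assumes xs: "filterlim xs at_infinity sequentially"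
    and lim: "(\<lambda>k. ln (L k) / ln (N k)) \<longlonglongrightarrow> l"
    and large: "\<forall>\<^sub>F k in sequentially. L k \<ge> 1 \<and>
      (\<forall>x\<in>cball (xs k) 1. 1 < norm x \<and> norm x \<le> N k \<and> exp (L k) \<le> \<bar>u x\<bar>)"
  shows "ereal l \<le> Limsup at_infinity (\<lambda>x0. INF x\<in>cball x0 1. loglog_ratio u x)"
proof (rule ccontr)
  assume "\<not> ?thesis"
  then obtain y where y: "Limsup at_infinity (\<lambda>x0. INF x\<in>cball x0 1. loglog_ratio u x) < y" "y < ereal l"
    using dense[of "Limsup at_infinity (\<lambda>x0. INF x\<in>cball x0 1. loglog_ratio u x)" "ereal l"]
    by (auto simp: not_le)
  have "eventually (\<lambda>k. (INF x\<in>cball (xs k) 1. loglog_ratio u x) < y) sequentially"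
    using xs Limsup_lessD[OF y(1)] by (rule eventually_compose_filterlim[rotated])
  moreover have "eventually (\<lambda>k. y < ereal (ln (L k) / ln (N k))) sequentially"
    using order_tendstoD(1)[OF tendsto_ereal[OF lim] y(2)] .
  ultimately have "eventually (\<lambda>k. False) sequentially"
    using large
  proof eventually_elim
    case (elim k)
    have "ereal (ln (L k) / ln (N k)) \<le> loglog_ratio u x" if "x \<in> cball (xs k) 1" for x
    proof -
      have x: "1 < norm x" "norm x \<le> N k" "exp (L k) \<le> \<bar>u x\<bar>" "1 \<le> L k"
        using elim(3) that by auto
      \<comment> \<open>This rules out the infinite values of \<open>lnln_abs\<close>.\<close>
      have u: "\<bar>u x\<bar> > 1" using x exp_ge_add_one_self[of "L k"] by linarith
      have "L k \<le> ln \<bar>u x\<bar>" using x u by (metis exp_gt_zero ln_exp ln_mono)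
      then have "ln (L k) \<le> ln \<bar>ln \<bar>u x\<bar>\<bar>" using x by simp
      moreover have lnx: "0 < ln (norm x)" using x(1) by (rule ln_gt_zero)
      moreover have "ln (norm x) \<le> ln (N k)"
        using x(1,2) by (subst ln_le_cancel_iff) linarith+
      moreover have "0 \<le> ln (L k)" using x by simp
      ultimately have "ln (L k) / ln (N k) \<le> ln \<bar>ln \<bar>u x\<bar>\<bar> / ln (norm x)"
        by (intro frac_le) auto
      then show ?thesis
        using u lnx by (auto simp: loglog_ratio_def lnln_abs_real)
    qed
    then have "ereal (ln (L k) / ln (N k)) \<le> (INF x\<in>cball (xs k) 1. loglog_ratio u x)"
      by (rule INF_greatest)
    with elim show False by (meson leD less_trans)
  qed
  then show False by simp
qed


section \<open>The function on real n-space and its exponent\<close>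

lemma exists_four_distinct:
  assumes "CARD('n::finite) \<ge> 4"
  obtains i j i' j' :: "'n::finite" where "i \<noteq> j" "i' \<noteq> j'" "i \<noteq> i'" "i \<noteq> j'" "j \<noteq> i'" "j \<noteq> j'"
proof -
  obtain f :: "nat \<Rightarrow> 'n" where f: "inj_on f {..<4}"
    using card_le_inj[of "{..<4::nat}" "UNIV :: 'n set"] assms by auto
  show ?thesis
    by (rule that[of "f 0" "f 1" "f 2" "f 3"]) (simp_all add: inj_on_eq_iff[OF f])
qed

text \<open>\<epsilon> is the reciprocal of the error bound for \<open>phase\<close>, so the scaled
  error v has modulus at most 1 < \<pi> / 3 and the cosine of its imaginary part is at least 1/2.
  The loss of 2 in the exponent pays for Re v \<ge> -1 and for this factor 1/2.\<close>

lemma osc_near_squares: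
  assumes \<epsilon>: "\<epsilon> = 1 / (5 * (32 * exp 8) ^ 4)"
    and k: "k \<ge> 1" "norm (z - (of_nat k) ^ 6) \<le> 1" "norm (w - (of_nat k)\<^sup>2) \<le> 1"
  shows "exp (3 / 4 * \<epsilon> * real k ^ 8 - 2) \<le> osc \<epsilon> z w"
proof -
  have \<epsilon>0: "\<epsilon> > 0" by (simp add: \<epsilon>)
  define c where "c = 3 / 4 * \<epsilon> * real k ^ 8"
  define v where "v = \<epsilon> * (phase z w - 3 / 4 * of_nat k ^ 8)"
  have "norm v = \<epsilon> * norm (phase z w - 3 / 4 * of_nat k ^ 8)"
    using \<epsilon>0 by (simp add: v_def norm_mult)
  also have "\<dots> \<le> \<epsilon> * (5 * (32 * exp 8) ^ 4)"
    using phase_near_squares[OF k] \<epsilon>0 by (intro mult_left_mono) auto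
  also have "\<dots> = 1" by (simp add: \<epsilon>)
  finally have v: "norm v \<le> 1" .
  have "\<epsilon> * phase z w = v + of_real c"
    by (simp add: v_def c_def algebra_simps)
  then have "Re (wave \<epsilon> z w) = exp (Re v + c) * cos (Im v)"
    by (simp add: wave_def Re_exp)
  moreover have "1 / 2 \<le> cos (Im v)"
  proof -
    have "cos (pi / 3) \<le> cos \<bar>Im v\<bar>"
      using abs_Im_le_cmod[of v] v pi_gt3 by (intro cos_monotone_0_pi_le) auto
    then show ?thesis by (simp add: cos_60)
  qed
  then have "exp (Re v + c) * (1 / 2) \<le> exp (Re v + c) * cos (Im v)"
    by (intro mult_left_mono) auto
  moreover have "exp (c - 2) \<le> exp (Re v + c) * (1 / 2)"
  proof -
    have "exp (c - 2) * 2 \<le> exp (c - 2) * exp 1"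
      using exp_ge_add_one_self[of 1] by (intro mult_left_mono) auto
    also have "\<dots> = exp (c - 1)" by (simp flip: exp_add)
    also have "\<dots> \<le> exp (Re v + c)"
      using abs_Re_le_cmod[of v] v by simp
    finally show ?thesis by simp
  qed
  ultimately show ?thesis unfolding osc_def c_def by linarith
qed

theorem mainTheorem3:
  assumes "CARD('n::finite) \<ge> 4"
  shows "\<exists>u :: real ^ 'n \<Rightarrow> real.
           smooth u \<and> (\<exists>x. u x \<noteq> 0) \<and>
           (\<exists>C::real. \<forall>x. \<bar>laplacian u x\<bar> \<le> C * \<bar>u x\<bar>) \<and>
           Limsup at_infinity (\<lambda>x\<^sub>0. INF x\<in>cball x\<^sub>0 1. loglog_ratio u x) = ereal (4 / 3)"
proof -
  obtain i j i' j' :: 'n where ij: "i \<noteq> j" "i' \<noteq> j'" "i \<noteq> i'" "i \<noteq> j'" "j \<noteq> i'" "j \<noteq> j'"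
    by (rule exists_four_distinct[OF assms])
  define p where "p = (coord_pair i j :: real ^ 'n \<Rightarrow> complex)"
  define q where "q = (coord_pair i' j' :: real ^ 'n \<Rightarrow> complex)"
  define \<epsilon> :: real where "\<epsilon> = 1 / (5 * (32 * exp 8) ^ 4)"
  have \<epsilon>: "\<epsilon> > 0" by (simp add: \<epsilon>_def)
  define u where "u x = osc \<epsilon> (p x) (q x)" for x
  have lin: "bounded_linear p" "bounded_linear q"
    by (simp_all add: p_def q_def bounded_linear_coord_pair)
  have norm_le: "norm (p x) \<le> norm x" "norm (q x) \<le> norm x" for x
    using ij by (simp_all add: p_def q_def norm_coord_pair_le)

  \<comment> \<open>The subtraction in \<open>phase\<close> is written as adding a negative, to
    match the closure rules of \<open>holo_alg\<close>.\<close>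
  define f where "f x = 2 + exp (\<epsilon> * (stair (p x) * stair (q x) + - (stair (q x) ^ 4 / 4)))" for x
  have f: "f \<in> holo_alg p q"
    unfolding f_def
  proof (intro holo_alg.add holo_alg.const)
    have "(\<lambda>x. stair (p x) * stair (q x) + - (stair (q x) ^ 4 / 4)) \<in> holo_alg p q"
      by (rule holo_alg.add[OF holo_alg.mult[OF holo_alg.comp[OF holomorphic_stair holo_alg.left]
              holo_alg.comp[OF holomorphic_stair holo_alg.right]]
            holo_alg.comp[of "\<lambda>z. - (stair z ^ 4 / 4)", OF _ holo_alg.right]])
         (intro holomorphic_intros holomorphic_stair; simp)
    then show "(\<lambda>x. exp (\<epsilon> * (stair (p x) * stair (q x) + - (stair (q x) ^ 4 / 4)))) \<in> holo_alg p q"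
      by (rule holo_alg.comp[of "\<lambda>z. exp (\<epsilon> * z)", rotated]) (intro holomorphic_intros)
  qed
  have u_eq: "u = (\<lambda>x. Re (f x))"
    by (rule ext) (simp add: f_def u_def osc_def wave_def phase_def)
  have smooth: "smooth u"
    unfolding u_eq by (rule smooth_Re_holo_alg[OF lin f])
  have lap: "laplacian u x = 0" for x
    unfolding u_eq using ij
    by (intro laplacian_Re_holo_alg[OF lin f])
       (simp_all add: p_def q_def coord_pair_isotropic coord_pair_orthogonal)

  obtain K where K: "K > 0"
    "\<And>z0 w0. \<exists>z w. norm (z - z0) \<le> 1 / 2 \<and> norm (w - w0) \<le> 1 / 2 \<and>
        exp (- (K * (1 + norm z0 + norm w0) powr (4 / 3))) \<le> \<bar>osc \<epsilon> z w\<bar> \<and>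
        \<bar>osc \<epsilon> z w\<bar> \<le> exp (K * (1 + norm z0 + norm w0) powr (4 / 3))"
    using osc_moderate[OF \<epsilon>] by metis
  \<comment> \<open>The factor comes from 1 + |p x0| + |q x0| \<le> 2 (1 + |x0|).\<close>
  define K' where "K' = K * 2 powr (4 / 3)"
  have moderate: "\<exists>x\<in>cball x0 1. exp (- (K' * (1 + norm x0) powr (4 / 3))) \<le> \<bar>u x\<bar> \<and>
      \<bar>u x\<bar> \<le> exp (K' * (1 + norm x0) powr (4 / 3))" for x0
  proof -
    obtain z w where zw: "norm (z - p x0) \<le> 1 / 2" "norm (w - q x0) \<le> 1 / 2"
      "exp (- (K * (1 + norm (p x0) + norm (q x0)) powr (4 / 3))) \<le> \<bar>osc \<epsilon> z w\<bar>"
      "\<bar>osc \<epsilon> z w\<bar> \<le> exp (K * (1 + norm (p x0) + norm (q x0)) powr (4 / 3))"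
      using K(2) by blast
    \<comment> \<open>Only the four chosen coordinates move, by at most 1/2 in each pair, so the
      polydisc lies over the unit ball.\<close>
    define x where "x = x0 + (embed_pair i j (z - p x0) + embed_pair i' j' (w - q x0))"
    have "p x = z" "q x = w"
      using ij by (simp_all add: x_def p_def q_def coord_pair_add coord_pair_embed_pair)
    then have ux: "u x = osc \<epsilon> z w" by (simp add: u_def)
    have "norm (x - x0) \<le> norm (z - p x0) + norm (w - q x0)"
      unfolding x_def using norm_triangle_ineq[of "embed_pair i j (z - p x0)" "embed_pair i' j' (w - q x0)"] ij
      by (simp add: norm_embed_pair)
    then have x: "x \<in> cball x0 1"
      using zw(1,2) by (simp add: dist_norm norm_minus_commute)
    have "(1 + norm (p x0) + norm (q x0)) powr (4 / 3) \<le> (2 * (1 + norm x0)) powr (4 / 3)"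
      using norm_le[of x0] by (intro powr_mono2) auto
    also have "\<dots> = 2 powr (4 / 3) * (1 + norm x0) powr (4 / 3)"
      by (rule powr_mult)
    finally have "K * (1 + norm (p x0) + norm (q x0)) powr (4 / 3) \<le> K' * (1 + norm x0) powr (4 / 3)"
      using K(1) by (simp add: K'_def)
    then have mono: "exp (K * (1 + norm (p x0) + norm (q x0)) powr (4 / 3)) \<le> exp (K' * (1 + norm x0) powr (4 / 3))"
      "exp (- (K' * (1 + norm x0) powr (4 / 3))) \<le> exp (- (K * (1 + norm (p x0) + norm (q x0)) powr (4 / 3)))"
      by simp_all
    then show ?thesis
      using x order_trans[OF mono(2) zw(3)] order_trans[OF zw(4) mono(1)]
      by (intro bexI[of _ x] conjI) (simp_all only: ux)
  qed
  have "K' > 0" using K by (simp add: K'_def)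
  have upper: "Limsup at_infinity (\<lambda>x0. INF x\<in>cball x0 1. loglog_ratio u x) \<le> ereal (4 / 3)"
    using \<open>K' > 0\<close> moderate by (rule Limsup_loglog_ratio_le)
  obtain x where "exp (- (K' * (1 + norm (0 :: real ^ 'n)) powr (4 / 3))) \<le> \<bar>u x\<bar>"
    using moderate[of 0] by blast
  then have nonzero: "u x \<noteq> 0"
    by (metis abs_zero exp_gt_zero not_le)

  \<comment> \<open>These centres satisfy S(z) = S(w)^3, the balance at which the phase attains the
    growth k^8 at distance about k^6.\<close>
  define xs where "xs k = embed_pair i j (of_nat k ^ 6) + embed_pair i' j' ((of_nat k)\<^sup>2)" for k
  have pq_xs: "p (xs k) = of_nat k ^ 6" "q (xs k) = (of_nat k)\<^sup>2" for k
    using ij by (simp_all add: xs_def p_def q_def coord_pair_add coord_pair_embed_pair)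
  have norm_xs_ge: "real k ^ 6 \<le> norm (xs k)" for k
    using norm_le(1)[of "xs k"] unfolding pq_xs by (simp add: norm_power)
  have norm_xs_le: "norm (xs k) \<le> real k ^ 6 + (real k)\<^sup>2" for k
    unfolding xs_def using ij
    by (intro order_trans[OF norm_triangle_ineq]) (simp add: norm_power norm_embed_pair)
  define L where "L k = 3 / 4 * \<epsilon> * real k ^ 8 - 2" for k
  define N where "N k = real k ^ 6 + (real k)\<^sup>2 + 1" for k
  have lower: "ereal (4 / 3) \<le> Limsup at_infinity (\<lambda>x0. INF x\<in>cball x0 1. loglog_ratio u x)"
  proof (rule le_Limsup_loglog_ratio)
    have "filterlim (\<lambda>k. real k ^ 6) at_top sequentially" by real_asymp
    then have "filterlim (\<lambda>k. norm (xs k)) at_top sequentially"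
      by (rule filterlim_at_top_mono) (simp add: norm_xs_ge)
    then show "filterlim xs at_infinity sequentially"
      by (rule filterlim_norm_at_top_imp_at_infinity)
    show "(\<lambda>k. ln (L k) / ln (N k)) \<longlonglongrightarrow> 4 / 3"
      using \<epsilon> unfolding L_def N_def by real_asymp
    have "\<forall>\<^sub>F k in sequentially. L k \<ge> 1"
      using \<epsilon> unfolding L_def by real_asymp
    then show "\<forall>\<^sub>F k in sequentially. L k \<ge> 1 \<and>
        (\<forall>x\<in>cball (xs k) 1. 1 < norm x \<and> norm x \<le> N k \<and> exp (L k) \<le> \<bar>u x\<bar>)"
      \<comment> \<open>From k = 2 on, |xs k| \<ge> 64, so the whole unit ball lies outside the
        closed unit ball about 0.\<close>
      using eventually_ge_at_top[of 2]
    proof eventually_elim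
      case (elim k)
      have "1 < norm x \<and> norm x \<le> N k \<and> exp (L k) \<le> \<bar>u x\<bar>" if "x \<in> cball (xs k) 1" for x
      proof -
        have d: "norm (x - xs k) \<le> 1" using that by (simp add: dist_norm norm_minus_commute)
        have "(2::real) ^ 6 \<le> real k ^ 6" using elim(2) by (intro power_mono) auto
        then have "1 < norm x"
          using d norm_xs_ge[of k] norm_triangle_ineq2[of "xs k" x] by (simp add: norm_minus_commute)
        moreover have "norm x \<le> N k"
          using d norm_xs_le[of k] norm_triangle_sub[of x "xs k"] by (simp add: N_def)
        moreover have "norm (p x - of_nat k ^ 6) \<le> 1" "norm (q x - (of_nat k)\<^sup>2) \<le> 1"
          using norm_le[of "x - xs k"] d pq_xs[of k] by (simp_all add: p_def q_def coord_pair_diff)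
        then have "exp (L k) \<le> u x"
          unfolding L_def u_def using elim(2) by (intro osc_near_squares \<epsilon>_def) auto
        ultimately show ?thesis by simp
      qed
      then show ?case using elim by blast
    qed
  qed
  \<comment> \<open>\<open>u\<close> is harmonic, so C = 0 serves in the differential
    inequality.\<close>
  show ?thesis
    using smooth lap nonzero antisym[OF upper lower] by (intro exI[of _ u] conjI exI[of _ x] exI[of _ 0]) auto
qed

end
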